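(* Let $\xi=(\xi_1,\xi_2,\ldots)$ be a symmetric swap-invariant sequence of random variables such that $\xi_1\neq 0$ almost surely. Put $\tilde\xi=(\xi_2/|\xi_1|,\xi_3/|\xi_1|,\ldots)$. Then $$\frac1n\sum_{i=1}^n\xi_i\ \to\ \frac{|\xi_1|}{\mathbf{E}(|\xi_1|\mid\mathcal{E}_{\tilde\xi})}\,\mathbf{E}(\xi_2\mid\mathcal{E}_{\tilde\xi})\qquad\text{almost surely and in }L^1\text{ as }n\to\infty .$$
   Context: Two integrable random vectors $\xi,\xi^*$ in $\mathbb{R}^d$ are zonoid equivalent if $\mathbf{E}|\langle u,\xi\rangle|=\mathbf{E}|\langle u,\xi^*\rangle|$ for all $u\in\mathbb{R}^d$. An integrable random vector is swap-invariant if all random vectors obtained by permutations of its coordinates are zonoid equivalent. A sequence of integrable random variables is swap-invariant if all its finite subsequences are swap-invariant (as random vectors). A random sequence $\xi$ is symmetric if $(\xi_1,\xi_2,\ldots)$ and $(-\xi_1,-\xi_2,\ldots)$ have the same distribution. For a random sequence $\zeta=(\zeta_1,\zeta_2,\ldots)$, $\mathcal{E}_\zeta$ denotes its permutation-invariant $\sigma$-field, i.e. the $\sigma$-field of events $\{\zeta\in B\}$ with $B\subset\mathbb{R}^\infty$ measurable and invariant under all finite permutations of coordinates. Expectations and conditional expectations are with respect to the underlying probability measure $\mathbf{P}$. *)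

theory Defs
  imports "HOL-Probability.Probability" "HOL-Combinatorics.Permutations"
begin

text \<open>
  A random vector in dimension \<open>d\<close> is a function \<open>X\<close> whose coordinates are \<open>X i\<close>, \<open>i < d\<close>
  (the values for \<open>i \<ge> d\<close> are irrelevant), so that \<open>d\<close> can be quantified over. The terms
  \<open>\<xi>\<^sub>1, \<xi>\<^sub>2, \<dots>\<close> of a random sequence are \<open>\<xi> 0, \<xi> 1, \<dots>\<close>.
\<close>

definition integrable_vector :: "'a measure \<Rightarrow> nat \<Rightarrow> (nat \<Rightarrow> 'a \<Rightarrow> real) \<Rightarrow> bool" where
  "integrable_vector M d X \<longleftrightarrow> (\<forall>i<d. integrable M (X i))"

text \<open>The two vectors may live on different probability spaces.\<close>

definition zonoid_equivalent ::
    "nat \<Rightarrow> 'a measure \<Rightarrow> (nat \<Rightarrow> 'a \<Rightarrow> real) \<Rightarrow> 'b measure \<Rightarrow> (nat \<Rightarrow> 'b \<Rightarrow> real) \<Rightarrow> bool" where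
  "zonoid_equivalent d M X N Y \<longleftrightarrow>
     integrable_vector M d X \<and> integrable_vector N d Y \<and>
     (\<forall>u :: nat \<Rightarrow> real.
        (\<integral>\<omega>. \<bar>\<Sum>i<d. u i * X i \<omega>\<bar> \<partial>M) = (\<integral>\<omega>. \<bar>\<Sum>i<d. u i * Y i \<omega>\<bar> \<partial>N))"

definition swap_invariant_vector :: "'a measure \<Rightarrow> nat \<Rightarrow> (nat \<Rightarrow> 'a \<Rightarrow> real) \<Rightarrow> bool" where
  "swap_invariant_vector M d X \<longleftrightarrow>
     integrable_vector M d X \<and>
     (\<forall>p q. p permutes {..<d} \<longrightarrow> q permutes {..<d} \<longrightarrow>
        zonoid_equivalent d M (\<lambda>i. X (p i)) M (\<lambda>i. X (q i)))"

definition swap_invariant :: "'a measure \<Rightarrow> (nat \<Rightarrow> 'a \<Rightarrow> real) \<Rightarrow> bool" where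
  "swap_invariant M \<xi> \<longleftrightarrow>
     (\<forall>i. integrable M (\<xi> i)) \<and>
     (\<forall>d s. strict_mono_on {..<d} s \<longrightarrow> swap_invariant_vector M d (\<lambda>i. \<xi> (s i)))"

abbreviation borel_seq :: "(nat \<Rightarrow> real) measure" where
  "borel_seq \<equiv> \<Pi>\<^sub>M i\<in>UNIV. borel"

definition symmetric_seq :: "'a measure \<Rightarrow> (nat \<Rightarrow> 'a \<Rightarrow> real) \<Rightarrow> bool" where
  "symmetric_seq M \<xi> \<longleftrightarrow>
     distr M borel_seq (\<lambda>\<omega> i. \<xi> i \<omega>) = distr M borel_seq (\<lambda>\<omega> i. - \<xi> i \<omega>)"

text \<open>\<^const>\<open>permutation\<close> describes the bijections that move only finitely many points.\<close>

definition perm_invariant_sets :: "(nat \<Rightarrow> real) set set" where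
  "perm_invariant_sets =
     {B \<in> sets borel_seq. \<forall>p. permutation p \<longrightarrow> (\<lambda>x i. x (p i)) -` B = B}"

text \<open>The generating family is already a \<open>\<sigma>\<close>-algebra, see \<open>sets_perm_invariant_field\<close>.\<close>

definition perm_invariant_field :: "'a measure \<Rightarrow> (nat \<Rightarrow> 'a \<Rightarrow> real) \<Rightarrow> 'a measure" where
  "perm_invariant_field M \<zeta> =
     sigma (space M) {{\<omega> \<in> space M. (\<lambda>i. \<zeta> i \<omega>) \<in> B} | B. B \<in> perm_invariant_sets}"

definition converges_L1 :: "'a measure \<Rightarrow> (nat \<Rightarrow> 'a \<Rightarrow> real) \<Rightarrow> ('a \<Rightarrow> real) \<Rightarrow> bool" where
  "converges_L1 M f g \<longleftrightarrow>
     (\<forall>n. integrable M (f n)) \<and> integrable M g \<and>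
     (\<lambda>n. \<integral>\<omega>. \<bar>f n \<omega> - g \<omega>\<bar> \<partial>M) \<longlonglongrightarrow> 0"

lemma space_borel_seq: "space borel_seq = UNIV"
  by (simp add: space_PiM)

lemma sigma_algebra_perm_invariant: "sigma_algebra UNIV perm_invariant_sets"
proof -
  have "UNIV - B \<in> perm_invariant_sets" if B: "B \<in> perm_invariant_sets" for B
  proof -
    have "space borel_seq - B \<in> sets borel_seq"
      using B unfolding perm_invariant_sets_def by blast
    then show ?thesis
      using B by (simp add: perm_invariant_sets_def space_borel_seq vimage_Diff)
  qed
  moreover have "(\<Union>n. A n) \<in> perm_invariant_sets"
    if A: "range A \<subseteq> perm_invariant_sets" for A :: "nat \<Rightarrow> (nat \<Rightarrow> real) set"
  proof -
    have "A n \<in> sets borel_seq" for n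
      using A unfolding perm_invariant_sets_def by blast
    then have "(\<Union>n. A n) \<in> sets borel_seq"
      by blast
    moreover have "(\<lambda>x i. x (p i)) -` A n = A n" if "permutation p" for p n
      using A that unfolding perm_invariant_sets_def by blast
    ultimately show ?thesis
      unfolding perm_invariant_sets_def by (simp add: vimage_UN)
  qed
  moreover have "{} \<in> perm_invariant_sets"
    by (simp add: perm_invariant_sets_def)
  ultimately show ?thesis
    by (simp add: sigma_algebra_iff2)
qed

lemma sets_perm_invariant_field:
  "sets (perm_invariant_field M \<zeta>) =
     {{\<omega> \<in> space M. (\<lambda>i. \<zeta> i \<omega>) \<in> B} | B. B \<in> perm_invariant_sets}"
proof -
  interpret S: sigma_algebra UNIV perm_invariant_sets
    by (rule sigma_algebra_perm_invariant)
  have eq: "{{\<omega> \<in> space M. (\<lambda>i. \<zeta> i \<omega>) \<in> B} | B. B \<in> perm_invariant_sets} =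
      {(\<lambda>\<omega> i. \<zeta> i \<omega>) -` B \<inter> space M | B. B \<in> perm_invariant_sets}"
    by (intro Collect_cong ex_cong1) auto
  have "sigma_sets (space M) {(\<lambda>\<omega> i. \<zeta> i \<omega>) -` B \<inter> space M | B. B \<in> perm_invariant_sets} =
      {(\<lambda>\<omega> i. \<zeta> i \<omega>) -` B \<inter> space M | B. B \<in> sigma_sets UNIV perm_invariant_sets}"
    by (rule sigma_sets_vimage_commute[symmetric]) auto
  then show ?thesis
    unfolding perm_invariant_field_def eq
    by (subst sets_measure_of) (auto simp: S.sigma_sets_eq)
qed

lemma subalgebra_perm_invariant_field:
  assumes "\<And>i. \<zeta> i \<in> borel_measurable M"
  shows "subalgebra M (perm_invariant_field M \<zeta>)"
proof -
  have m: "(\<lambda>\<omega> i. \<zeta> i \<omega>) \<in> measurable M borel_seq"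
    using assms by (intro measurable_PiM_single') auto
  have "{\<omega> \<in> space M. (\<lambda>i. \<zeta> i \<omega>) \<in> B} \<in> sets M" if "B \<in> perm_invariant_sets" for B
    using measurable_sets[OF m, of B] that
    by (simp add: perm_invariant_sets_def vimage_def Int_def conj_commute)
  moreover have "space (perm_invariant_field M \<zeta>) = space M"
    by (auto simp: perm_invariant_field_def space_measure_of_conv)
  ultimately show ?thesis
    unfolding subalgebra_def sets_perm_invariant_field by auto
qed

end

theory Submission
  imports Defs
begin

text \<open>
  Under the measure with density \<open>\<bar>\<xi>\<^sub>1\<bar>\<close> the sequence \<open>\<xi>\<^sub>2/\<bar>\<xi>\<^sub>1\<bar>, \<xi>\<^sub>3/\<bar>\<xi>\<^sub>1\<bar>, \<dots>\<close> is exchangeable: the absolute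
  moments \<open>E \<bar>t \<xi>\<^sub>1 + \<Sum> v\<^sub>j \<xi>\<^sub>j\<bar>\<close>, as functions of \<open>t\<close>, determine the law of every linear form in the
  ratios \<open>\<xi>\<^sub>j/\<xi>\<^sub>1\<close> (differentiate in \<open>t\<close>), symmetry of \<open>\<xi>\<close> turns this into the characteristic function of
  the ratios \<open>\<xi>\<^sub>j/\<bar>\<xi>\<^sub>1\<bar>\<close>, and the Cramer-Wold device applies. For an exchangeable sequence, a maximal
  inequality on permutation-invariant events bounds the upper and lower limits of the averages by the
  conditional expectation, which gives almost sure convergence; Scheffe's lemma, applied to positive and
  negative parts, gives convergence in \<open>L\<^sup>1\<close>. Bayes' formula expresses the conditional expectation
  under the new measure as a quotient of conditional expectations under \<open>P\<close>.
\<close>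

subsection \<open>Laws determined by absolute moments and by cosine integrals\<close>

text \<open>The sequence is the left difference quotient of t -> E|t + X| at t = -a. Approaching
  from the left gives slope -1 also where X = a, which is why the closed half-line, and hence the
  cdf, appears in the limit.\<close>

lemma tendsto_integral_abs_quotient:
  assumes "finite_measure N" and X: "integrable N (X :: 'a \<Rightarrow> real)"
  shows "(\<lambda>n. (\<integral>\<omega>. \<bar>- a + X \<omega>\<bar> \<partial>N) * Suc n - (\<integral>\<omega>. \<bar>(- a - 1 / Suc n) + X \<omega>\<bar> \<partial>N) * Suc n)
    \<longlonglongrightarrow> measure N (space N) - 2 * measure (distr N borel X) {..a}"
proof -
  interpret finite_measure N by fact
  have [measurable]: "X \<in> borel_measurable N" using X by auto
  define q where "q n \<omega> = \<bar>- a + X \<omega>\<bar> * real (Suc n) - \<bar>(- a - 1 / Suc n) + X \<omega>\<bar> * real (Suc n)" for n \<omega>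
  have "(\<lambda>n. \<integral>\<omega>. q n \<omega> \<partial>N) \<longlonglongrightarrow> (\<integral>\<omega>. 1 - 2 * indicator (X -` {..a} \<inter> space N) \<omega> \<partial>N)"
  proof (rule integral_dominated_convergence[where w="\<lambda>_. 1"])
    show "AE \<omega> in N. (\<lambda>n. q n \<omega>) \<longlonglongrightarrow> 1 - 2 * indicator (X -` {..a} \<inter> space N) \<omega>"
    proof (rule AE_I2)
      fix \<omega> assume \<omega>: "\<omega> \<in> space N"
      show "(\<lambda>n. q n \<omega>) \<longlonglongrightarrow> 1 - 2 * indicator (X -` {..a} \<inter> space N) \<omega>"
      proof (cases "X \<omega> \<le> a")
        case True
        have "q n \<omega> = -1" for n
        proof -
          have "0 < 1 / real (Suc n)" by simp
          with True have "\<bar>(- a - 1 / Suc n) + X \<omega>\<bar> = a + 1 / Suc n - X \<omega>" "\<bar>- a + X \<omega>\<bar> = a - X \<omega>"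
            by linarith+
          then show ?thesis unfolding q_def by (simp add: field_simps)
        qed
        then show ?thesis using True \<omega> by simp
      next
        case False
        have "\<forall>\<^sub>F n in sequentially. 1 / real (Suc n) < X \<omega> - a"
          using order_tendstoD(2)[OF LIMSEQ_inverse_real_of_nat, of "X \<omega> - a"] False
          by (simp add: inverse_eq_divide)
        then have "\<forall>\<^sub>F n in sequentially. q n \<omega> = 1"
        proof eventually_elim
          case (elim n)
          then have "\<bar>(- a - 1 / Suc n) + X \<omega>\<bar> = X \<omega> - a - 1 / Suc n" "\<bar>- a + X \<omega>\<bar> = X \<omega> - a"
            using False by auto
          then show ?case unfolding q_def by (simp add: field_simps)
        qed
        then show ?thesis using False tendsto_eventually by (auto simp: indicator_def)
      qed
    qed
    show "AE \<omega> in N. norm (q n \<omega>) \<le> 1" for n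
    proof (rule AE_I2)
      fix \<omega>
      have "\<bar>\<bar>- a + X \<omega>\<bar> - \<bar>(- a - 1 / Suc n) + X \<omega>\<bar>\<bar> \<le> 1 / Suc n"
        by (smt (verit) divide_nonneg_nonneg of_nat_0_le_iff)
      then have "\<bar>\<bar>- a + X \<omega>\<bar> - \<bar>(- a - 1 / Suc n) + X \<omega>\<bar>\<bar> * Suc n \<le> 1 / Suc n * Suc n"
        by (rule mult_right_mono) simp
      moreover have "norm (q n \<omega>) = \<bar>\<bar>- a + X \<omega>\<bar> - \<bar>(- a - 1 / Suc n) + X \<omega>\<bar>\<bar> * Suc n"
        unfolding q_def left_diff_distrib[symmetric] by (simp add: abs_mult del: of_nat_Suc)
      ultimately show "norm (q n \<omega>) \<le> 1" by simp
    qed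
  qed (auto simp: q_def)
  moreover have "(\<integral>\<omega>. q n \<omega> \<partial>N) = (\<integral>\<omega>. \<bar>- a + X \<omega>\<bar> \<partial>N) * Suc n
      - (\<integral>\<omega>. \<bar>(- a - 1 / Suc n) + X \<omega>\<bar> \<partial>N) * Suc n" for n
    unfolding q_def using X by (subst Bochner_Integration.integral_diff) auto
  moreover have "(\<integral>\<omega>. 1 - 2 * indicator (X -` {..a} \<inter> space N) \<omega> \<partial>N)
      = measure N (space N) - 2 * measure (distr N borel X) {..a}"
    by (subst Bochner_Integration.integral_diff) (auto simp: measure_distr emeasure_eq_measure)
  ultimately show ?thesis by simp
qed

text \<open>The left derivative of E|t + X| at -a is the total mass minus twice the cdf at a. Both
  variables live on \<open>N\<close>, so the mass cancels and the cdfs agree everywhere.\<close>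

lemma distr_eq_of_abs_moments:
  assumes N: "finite_measure N" and X: "integrable N X" and Y: "integrable N Y"
    and eq: "\<And>t :: real. (\<integral>\<omega>. \<bar>t + X \<omega>\<bar> \<partial>N) = (\<integral>\<omega>. \<bar>t + Y \<omega>\<bar> \<partial>N)"
  shows "distr N borel X = distr N borel Y"
proof (rule cdf_unique')
  interpret finite_measure N by fact
  have [measurable]: "X \<in> borel_measurable N" "Y \<in> borel_measurable N" using X Y by auto
  show "finite_borel_measure (distr N borel X)" "finite_borel_measure (distr N borel Y)"
    by (auto simp: finite_borel_measure_def finite_borel_measure_axioms_def intro!: finite_measure_distr)
  show "cdf (distr N borel X) = cdf (distr N borel Y)"
  proof
    fix a
    show "cdf (distr N borel X) a = cdf (distr N borel Y) a"
      using LIMSEQ_unique[OF tendsto_integral_abs_quotient[OF N X, of a]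
          tendsto_integral_abs_quotient[OF N Y, of a, folded eq]]
      by (simp add: cdf_def)
  qed
qed

section \<open>Uniqueness of finite measures from their cosine integrals\<close>

text \<open>\<open>Levy_uniqueness\<close> concerns probability measures, hence the division by the
  mass. The sine part is written as a cosine with phase -pi/2, so that cosine integrals with
  arbitrary phases determine the whole characteristic function.\<close>

lemma char_normalised:
  assumes "finite_borel_measure \<mu>" and m: "m = measure \<mu> (space \<mu>)" "m > 0"
  defines "\<mu>' \<equiv> density \<mu> (\<lambda>_. ennreal (1 / m))"
  shows "real_distribution \<mu>'"
    and "char \<mu>' t = Complex ((\<integral>x. cos (t * x + 0) \<partial>\<mu>) / m) ((\<integral>x. cos (t * x - pi / 2) \<partial>\<mu>) / m)"
proof -
  interpret finite_borel_measure \<mu> by fact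
  note M_is_borel[measurable_cong]
  have "emeasure \<mu>' (space \<mu>') = ennreal (1 / m) * emeasure \<mu> (space \<mu>)"
    unfolding \<mu>'_def by (simp add: emeasure_density nn_integral_cmult)
  also have "\<dots> = 1"
    using m by (simp add: emeasure_eq_measure flip: ennreal_mult)
  finally have "prob_space \<mu>'" by (rule prob_spaceI)
  then show "real_distribution \<mu>'"
    by (simp add: real_distribution_def real_distribution_axioms_def \<mu>'_def M_is_borel borel_UNIV)
  have iexp: "iexp (t * x) = Complex (cos (t * x + 0)) (cos (t * x - pi / 2))" for x
    by (simp add: complex_eq_iff Re_exp Im_exp cos_diff)
  have int: "integrable \<mu> (\<lambda>x. iexp (t * x))"
    by (rule integrable_const_bound[where B=1]) (auto simp: norm_exp_i_times)
  have "char \<mu>' t = (CLINT x|\<mu>. (1 / m) *\<^sub>R iexp (t * x))"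
    unfolding char_def \<mu>'_def using m by (subst integral_density) auto
  also have "\<dots> = (1 / m) *\<^sub>R (CLINT x|\<mu>. iexp (t * x))"
    by simp
  also have "\<dots> = Complex ((\<integral>x. cos (t * x + 0) \<partial>\<mu>) / m) ((\<integral>x. cos (t * x - pi / 2) \<partial>\<mu>) / m)"
    using integral_Re[OF int, symmetric] integral_Im[OF int, symmetric]
    by (simp only: complex_eq_iff iexp complex.sel scaleR_complex.sel) simp
  finally show "char \<mu>' t = Complex ((\<integral>x. cos (t * x + 0) \<partial>\<mu>) / m) ((\<integral>x. cos (t * x - pi / 2) \<partial>\<mu>) / m)" .
qed

lemma finite_borel_measure_eq_of_cos:
  assumes \<mu>: "finite_borel_measure \<mu>" and \<nu>: "finite_borel_measure \<nu>"
    and eq: "\<And>t a. (\<integral>x. cos (t * x + a) \<partial>\<mu>) = (\<integral>x. cos (t * x + a) \<partial>\<nu>)"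
  shows "\<mu> = \<nu>"
proof -
  interpret \<mu>: finite_borel_measure \<mu> by fact
  interpret \<nu>: finite_borel_measure \<nu> by fact
  define m where "m = measure \<mu> (space \<mu>)"
  \<comment> \<open>At t = a = 0 the integrand is constantly 1, so the hypothesis also equates the
    total masses and one \<open>m\<close> normalises both measures.\<close>
  have m': "m = measure \<nu> (space \<nu>)"
    using eq[of 0 0] by (simp add: m_def)
  have sets: "sets \<mu> = sets \<nu>" by (simp add: \<mu>.M_is_borel \<nu>.M_is_borel)
  show ?thesis
  proof (cases "m > 0")
    case True
    have "density \<mu> (\<lambda>_. ennreal (1 / m)) = density \<nu> (\<lambda>_. ennreal (1 / m))"
      using char_normalised(1)[OF \<mu> m_def True] char_normalised(1)[OF \<nu> m' True]
      by (rule Levy_uniqueness)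
        (simp only: fun_eq_iff char_normalised(2)[OF \<mu> m_def True] char_normalised(2)[OF \<nu> m' True]
          diff_conv_add_uminus eq simp_thms)
    then have "ennreal (1 / m) * emeasure \<mu> A = ennreal (1 / m) * emeasure \<nu> A" if "A \<in> sets \<mu>" for A
      using that sets emeasure_density_const[of A \<mu> "ennreal (1 / m)"]
        emeasure_density_const[of A \<nu> "ennreal (1 / m)"] by simp
    then show ?thesis
      using True sets by (intro measure_eqI) (auto simp: ennreal_mult_cancel_left)
  next
    \<comment> \<open>Mass zero cannot be normalised, but then both measures vanish on every
      set.\<close>
    case False
    then have "measure \<mu> (space \<mu>) = 0" "measure \<nu> (space \<nu>) = 0"
      using m' by (auto simp: m_def zero_less_measure_iff)
    then have "emeasure \<mu> A = 0" "emeasure \<nu> A = 0" for A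
      using \<mu>.bounded_measure[of A] \<nu>.bounded_measure[of A]
      by (simp_all add: \<mu>.emeasure_eq_measure \<nu>.emeasure_eq_measure measure_le_0_iff)
    then show ?thesis using sets by (intro measure_eqI) auto
  qed
qed

text \<open>The hypothesis speaks about the images under \<open>X\<close> and \<open>Y\<close> of
  the measures with densities \<open>f\<close> and \<open>g\<close>. Nonnegativity and integrability
  make these finite Borel measures, so uniqueness on the line applies.\<close>

lemma weighted_indicator_eq_of_cos:
  fixes f g X Y :: "'a \<Rightarrow> real"
  assumes f: "integrable \<mu> f" "\<And>x. f x \<ge> 0" and g: "integrable \<nu> g" "\<And>x. g x \<ge> 0"
    and [measurable]: "X \<in> borel_measurable \<mu>" "Y \<in> borel_measurable \<nu>" "B \<in> sets borel"
    and eq: "\<And>t a. (\<integral>x. f x * cos (t * X x + a) \<partial>\<mu>) = (\<integral>x. g x * cos (t * Y x + a) \<partial>\<nu>)"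
  shows "(\<integral>x. f x * indicator B (X x) \<partial>\<mu>) = (\<integral>x. g x * indicator B (Y x) \<partial>\<nu>)"
proof -
  have [measurable]: "f \<in> borel_measurable \<mu>" "g \<in> borel_measurable \<nu>" using f g by auto
  define law where "law \<rho> h Z = distr (density \<rho> (\<lambda>x. ennreal (h x))) borel Z"
    for \<rho> :: "'a measure" and h Z :: "'a \<Rightarrow> real"
  have fin: "finite_borel_measure (law \<rho> h Z)"
    if "integrable \<rho> h" "\<And>x. h x \<ge> 0" and [measurable]: "Z \<in> borel_measurable \<rho>" for \<rho> h Z
  proof -
    have [measurable]: "h \<in> borel_measurable \<rho>" using that by auto
    have "finite_measure (density \<rho> (\<lambda>x. ennreal (h x)))"
      using that by (intro finite_measureI) (simp add: emeasure_density nn_integral_eq_integral)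
    then show ?thesis
      unfolding law_def finite_borel_measure_def finite_borel_measure_axioms_def
      by (auto intro: finite_measure.finite_measure_distr)
  qed
  have int: "(\<integral>x. k x \<partial>law \<rho> h Z) = (\<integral>x. h x * k (Z x) \<partial>\<rho>)"
    if "integrable \<rho> h" "\<And>x. h x \<ge> 0" and [measurable]: "Z \<in> borel_measurable \<rho>" "k \<in> borel_measurable borel"
    for \<rho> h Z and k :: "real \<Rightarrow> real"
  proof -
    have [measurable]: "h \<in> borel_measurable \<rho>" using that by auto
    show ?thesis unfolding law_def using that by (simp add: integral_distr integral_density)
  qed
  have "law \<mu> f X = law \<nu> g Y"
    using fin[OF f] fin[OF g] by (rule finite_borel_measure_eq_of_cos) (auto simp: int f g eq)
  moreover have "(\<integral>x. f x * indicator B (X x) \<partial>\<mu>) = (\<integral>x. indicator B x \<partial>law \<mu> f X)"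
    using f by (intro int[symmetric]) auto
  moreover have "(\<integral>x. g x * indicator B (Y x) \<partial>\<nu>) = (\<integral>x. indicator B x \<partial>law \<nu> g Y)"
    using g by (intro int[symmetric]) auto
  ultimately show ?thesis by simp
qed

lemma (in finite_measure) integrable_abs_le_one_mult:
  fixes f g :: "'a \<Rightarrow> real"
  assumes [measurable]: "f \<in> borel_measurable M" "g \<in> borel_measurable M"
    and "\<And>x. \<bar>f x\<bar> \<le> 1" "\<And>x. \<bar>g x\<bar> \<le> 1"
  shows "integrable M (\<lambda>x. f x * g x)"
  by (rule integrable_const_bound[where B=1]) (use assms in \<open>auto simp: abs_mult intro!: AE_I2 mult_le_one\<close>)

text \<open>Induction on \<open>k\<close>: one coordinate at a time is moved from the exponent into the box. The weights
  \<open>1 + cos (\<dots>)\<close> are nonnegative, so uniqueness for finite measures on the line suffices.\<close>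

lemma cos_box_integral_eq:
  fixes \<mu> \<nu> :: "(nat \<Rightarrow> real) measure"
  assumes \<mu>: "finite_measure \<mu>" "sets \<mu> = sets borel_seq"
    and \<nu>: "finite_measure \<nu>" "sets \<nu> = sets borel_seq"
    and eq: "\<And>n v a. (\<integral>x. cos ((\<Sum>j<n. v j * x j) + a) \<partial>\<mu>) = (\<integral>x. cos ((\<Sum>j<n. v j * x j) + a) \<partial>\<nu>)"
    and B: "\<And>j. B j \<in> sets borel" and "k \<le> n"
  shows "(\<integral>x. (\<Prod>j<k. indicator (B j) (x j)) * cos ((\<Sum>j<n. v j * x j) + a) \<partial>\<mu>)
       = (\<integral>x. (\<Prod>j<k. indicator (B j) (x j)) * cos ((\<Sum>j<n. v j * x j) + a) \<partial>\<nu>)"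
  using \<open>k \<le> n\<close>
proof (induction k arbitrary: v a)
  case 0
  then show ?case using eq by simp
next
  case (Suc k)
  note \<mu>(2)[measurable_cong] \<nu>(2)[measurable_cong]
  have [measurable]: "B j \<in> sets borel" for j by (fact B)
  define W where "W x = (\<Prod>j<k. indicator (B j) (x j) :: real)" for x
  define \<theta> where "\<theta> v x = (\<Sum>j<n. v j * x j)" for v x :: "nat \<Rightarrow> real"
  have W: "0 \<le> W x" "W x \<le> 1" for x
    unfolding W_def by (auto intro!: prod_nonneg prod_le_1)
  have [measurable]: "W \<in> borel_measurable borel_seq" "\<theta> v \<in> borel_measurable borel_seq" for v
    unfolding W_def \<theta>_def by measurable
  have IH: "(\<integral>x. W x * cos (\<theta> v x + a) \<partial>\<mu>) = (\<integral>x. W x * cos (\<theta> v x + a) \<partial>\<nu>)" for v a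
    using Suc by (simp add: W_def \<theta>_def)
  have \<theta>_upd: "\<theta> (v(k := v k + t)) x = \<theta> v x + t * x k" for v t x
    using Suc.prems unfolding \<theta>_def
    by (simp add: sum.remove[of "{..<n}" k] algebra_simps)
  have \<theta>_single: "\<theta> ((\<lambda>_. 0)(k := t)) x = t * x k" for t x
    using \<theta>_upd[of "\<lambda>_. 0" t x] by (simp add: \<theta>_def)
  have step: "(\<integral>x. W x * (1 + cos (\<theta> v x + a)) * indicator (B k) (x k) \<partial>\<mu>)
            = (\<integral>x. W x * (1 + cos (\<theta> v x + a)) * indicator (B k) (x k) \<partial>\<nu>)" for v a
  proof (rule weighted_indicator_eq_of_cos)
    have "integrable \<rho> (\<lambda>x. W x * (1 + cos (\<theta> v x + a)))"
      if "finite_measure \<rho>" and [measurable_cong]: "sets \<rho> = sets borel_seq" for \<rho>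
    proof -
      interpret finite_measure \<rho> by fact
      show ?thesis
      proof (rule integrable_const_bound[where B=2])
        show "AE x in \<rho>. norm (W x * (1 + cos (\<theta> v x + a))) \<le> 2"
        proof (rule AE_I2)
          fix x
          have "\<bar>1 + cos (\<theta> v x + a)\<bar> \<le> 2"
            using abs_cos_le_one[of "\<theta> v x + a"] by linarith
          then have "W x * \<bar>1 + cos (\<theta> v x + a)\<bar> \<le> 1 * 2"
            using W by (intro mult_mono) auto
          then show "norm (W x * (1 + cos (\<theta> v x + a))) \<le> 2"
            using W by (simp add: abs_mult)
        qed
      qed measurable
    qed
    then show "integrable \<mu> (\<lambda>x. W x * (1 + cos (\<theta> v x + a)))" "integrable \<nu> (\<lambda>x. W x * (1 + cos (\<theta> v x + a)))"
      using \<mu> \<nu> by auto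
    have "0 \<le> 1 + cos (\<theta> v x + a)" for x
      using cos_ge_minus_one[of "\<theta> v x + a"] by linarith
    then show "0 \<le> W x * (1 + cos (\<theta> v x + a))" "0 \<le> W x * (1 + cos (\<theta> v x + a))" for x
      by (simp_all add: W)
    fix t b
    \<comment> \<open>The product formula for cosines turns the weighted cosine into three pure
      cosines of linear forms. Each differs from the given data only in the coefficient of
      \<open>x k\<close> and in the phase, so the induction hypothesis covers it.\<close>
    have "(\<integral>x. W x * (1 + cos (\<theta> v x + a)) * cos (t * x k + b) \<partial>\<rho>) =
        (\<integral>x. W x * cos (\<theta> ((\<lambda>_. 0)(k := t)) x + b) \<partial>\<rho>)
        + (\<integral>x. W x * cos (\<theta> (v(k := v k + t)) x + (a + b)) \<partial>\<rho>) / 2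
        + (\<integral>x. W x * cos (\<theta> (v(k := v k + (- t))) x + (a - b)) \<partial>\<rho>) / 2"
      if "finite_measure \<rho>" and [measurable_cong]: "sets \<rho> = sets borel_seq" for \<rho>
    proof -
      interpret finite_measure \<rho> by fact
      have [simp]: "integrable \<rho> (\<lambda>x. W x * cos (\<theta> v x + a))" for v a
        by (rule integrable_abs_le_one_mult) (simp_all add: W)
      have "W x * (1 + cos (\<theta> v x + a)) * cos (t * x k + b) =
          W x * cos (\<theta> ((\<lambda>_. 0)(k := t)) x + b)
          + W x * cos (\<theta> (v(k := v k + t)) x + (a + b)) / 2
          + W x * cos (\<theta> (v(k := v k + (- t))) x + (a - b)) / 2" for x
      proof -
        have "cos (\<theta> v x + a) * cos (t * x k + b) =
            (cos ((\<theta> v x + a) - (t * x k + b)) + cos ((\<theta> v x + a) + (t * x k + b))) / 2"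
          by (rule cos_times_cos)
        then show ?thesis
          unfolding \<theta>_single \<theta>_upd by (simp add: algebra_simps add_divide_distrib)
      qed
      then show ?thesis by simp
    qed
    then show "(\<integral>x. W x * (1 + cos (\<theta> v x + a)) * cos (t * x k + b) \<partial>\<mu>) =
        (\<integral>x. W x * (1 + cos (\<theta> v x + a)) * cos (t * x k + b) \<partial>\<nu>)"
      using \<mu> \<nu> by (simp only: IH)
  qed simp_all
  \<comment> \<open>The auxiliary summand 1 in the weight is removed again: for the zero form and
    phase 0 the weight is the constant 2, and half of that integral is the excess.\<close>
  have "(\<integral>x. (\<Prod>j<Suc k. indicator (B j) (x j)) * cos (\<theta> v x + a) \<partial>\<rho>)
      = (\<integral>x. W x * (1 + cos (\<theta> v x + a)) * indicator (B k) (x k) \<partial>\<rho>)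
        - (\<integral>x. W x * (1 + cos (\<theta> (\<lambda>_. 0) x + 0)) * indicator (B k) (x k) \<partial>\<rho>) / 2"
    if "finite_measure \<rho>" and [measurable_cong]: "sets \<rho> = sets borel_seq" for \<rho>
  proof -
    interpret finite_measure \<rho> by fact
    have [simp]: "integrable \<rho> (\<lambda>x. W x * cos (\<theta> v x + a) * indicator (B k) (x k))" for v a
      by (rule integrable_abs_le_one_mult) (simp_all add: W abs_mult mult_le_one indicator_def)
    have [simp]: "integrable \<rho> (\<lambda>x. W x * indicator (B k) (x k))"
      by (rule integrable_abs_le_one_mult) (simp_all add: W indicator_def)
    have prod: "(\<integral>x. (\<Prod>j<Suc k. indicator (B j) (x j)) * cos (\<theta> v x + a) \<partial>\<rho>)
      = (\<integral>x. W x * cos (\<theta> v x + a) * indicator (B k) (x k) \<partial>\<rho>)"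
      by (simp add: W_def mult_ac)
    have split: "(\<integral>x. W x * (1 + cos (\<theta> v x + a)) * indicator (B k) (x k) \<partial>\<rho>)
      = (\<integral>x. W x * indicator (B k) (x k) \<partial>\<rho>) + (\<integral>x. W x * cos (\<theta> v x + a) * indicator (B k) (x k) \<partial>\<rho>)"
      for v a
      by (simp add: distrib_left distrib_right)
    have "\<theta> (\<lambda>_. 0) x = 0" for x
      by (simp add: \<theta>_def)
    then show ?thesis
      unfolding prod split by simp
  qed
  note indicator_integral = this
  show ?case
    unfolding \<theta>_def[symmetric] indicator_integral[OF \<mu>] indicator_integral[OF \<nu>]
    by (simp only: step)
qed

text \<open>The Cramer-Wold device in sequence space. With all coordinates moved into the box and
  nothing left in the exponent, the cosine integrals give the masses of the finite-dimensional
  boxes, which determine a finite measure.\<close>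

lemma measure_eq_of_cos:
  fixes \<mu> \<nu> :: "(nat \<Rightarrow> real) measure"
  assumes \<mu>: "finite_measure \<mu>" "sets \<mu> = sets borel_seq"
    and \<nu>: "finite_measure \<nu>" "sets \<nu> = sets borel_seq"
    and eq: "\<And>n v a. (\<integral>x. cos ((\<Sum>j<n. v j * x j) + a) \<partial>\<mu>) = (\<integral>x. cos ((\<Sum>j<n. v j * x j) + a) \<partial>\<nu>)"
  shows "\<mu> = \<nu>"
proof (rule measure_eqI_PiM_infinite[OF \<mu>(2) \<nu>(2)])
  note \<mu>(2)[measurable_cong] \<nu>(2)[measurable_cong]
  show "finite_measure \<mu>" by fact
  fix A :: "nat \<Rightarrow> real set" and J
  assume J: "finite J" "J \<subseteq> UNIV" and A: "\<And>i. i \<in> J \<Longrightarrow> A i \<in> sets borel"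
  \<comment> \<open>Filling the missing coordinates with \<open>UNIV\<close> turns a box over
    \<open>J\<close> into a box over an initial segment of the indices.\<close>
  define B where "B j = (if j \<in> J then A j else UNIV)" for j
  have [measurable]: "B j \<in> sets borel" for j using A by (simp add: B_def)
  obtain n where n: "J \<subseteq> {..<n}" using J finite_nat_iff_bounded by blast
  have box: "prod_emb UNIV (\<lambda>_. borel) J (Pi\<^sub>E J A) = {x. \<forall>j<n. x j \<in> B j}"
    using n by (auto simp: prod_emb_def B_def PiE_def Pi_def restrict_def extensional_def)
  \<comment> \<open>The factor cos 0 = 1 is kept only to match the shape of
    \<open>cos_box_integral_eq\<close> with zero coefficients and phase.\<close>
  have "measure \<rho> {x. \<forall>j<n. x j \<in> B j}
      = (\<integral>x. (\<Prod>j<n. indicator (B j) (x j)) * cos ((\<Sum>j<n. 0 * x j) + 0) \<partial>\<rho>)"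
    if "finite_measure \<rho>" and [measurable_cong]: "sets \<rho> = sets borel_seq" for \<rho>
  proof -
    have "space \<rho> = UNIV"
      using sets_eq_imp_space_eq[OF that(2)] by (simp add: space_borel_seq)
    then have "measure \<rho> {x. \<forall>j<n. x j \<in> B j} = (\<integral>x. indicator {x. \<forall>j<n. x j \<in> B j} x \<partial>\<rho>)"
      by simp
    also have "\<dots> = (\<integral>x. (\<Prod>j<n. indicator (B j) (x j)) * cos ((\<Sum>j<n. 0 * x j) + 0) \<partial>\<rho>)"
      by (intro Bochner_Integration.integral_cong) (auto simp: indicator_def prod_zero_iff)
    finally show ?thesis .
  qed
  then show "emeasure \<mu> (prod_emb UNIV (\<lambda>_. borel) J (Pi\<^sub>E J A)) = emeasure \<nu> (prod_emb UNIV (\<lambda>_. borel) J (Pi\<^sub>E J A))"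
    using \<mu> \<nu> cos_box_integral_eq[OF \<mu> \<nu> eq, of B n n "\<lambda>_. 0" 0]
    by (simp add: box finite_measure.emeasure_eq_measure)
qed

subsection \<open>The maximal inequality for exchangeable sequences\<close>

text \<open>This is the maximum of the sums of the first k terms over k from 0 to n, the empty sum
  included. The recursive form is the identity on which Garsia's argument rests.\<close>

primrec max_partial_sum :: "nat \<Rightarrow> (nat \<Rightarrow> real) \<Rightarrow> real" where
  "max_partial_sum 0 y = 0"
| "max_partial_sum (Suc n) y = max 0 (y 0 + max_partial_sum n (\<lambda>i. y (Suc i)))"

lemma max_partial_sum_nonneg: "0 \<le> max_partial_sum n y"
  by (cases n) auto

lemma max_partial_sum_mono: "max_partial_sum n y \<le> max_partial_sum (Suc n) y"
proof (induction n arbitrary: y)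
  case (Suc n)
  then show ?case
    using max.mono[OF order_refl add_left_mono[OF Suc[of "\<lambda>i. y (Suc i)"], of "y 0"], of 0] by simp
qed simp

lemma max_partial_sum_cong: "(\<And>i. i < n \<Longrightarrow> y i = z i) \<Longrightarrow> max_partial_sum n y = max_partial_sum n z"
proof (induction n arbitrary: y z)
  case (Suc n)
  have "max_partial_sum n (\<lambda>i. y (Suc i)) = max_partial_sum n (\<lambda>i. z (Suc i))"
    by (rule Suc.IH) (simp add: Suc.prems)
  then show ?case using Suc.prems[of 0] by simp
qed simp

lemma sum_le_max_partial_sum: "(\<Sum>i<n. y i) \<le> max_partial_sum n y"
proof (induction n arbitrary: y)
  case (Suc n)
  show ?case
    using Suc[of "\<lambda>i. y (Suc i)"] by (simp add: sum.lessThan_Suc_shift del: sum.lessThan_Suc)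
qed simp

lemma max_partial_sum_le: "max_partial_sum n y \<le> (\<Sum>i<n. \<bar>y i\<bar>)"
proof (induction n arbitrary: y)
  case (Suc n)
  have "0 \<le> (\<Sum>i<n. \<bar>y (Suc i)\<bar>)" by (simp add: sum_nonneg)
  then show ?case
    using Suc[of "\<lambda>i. y (Suc i)"] by (simp add: sum.lessThan_Suc_shift del: sum.lessThan_Suc)
qed simp

lemma measurable_max_partial_sum [measurable (raw)]:
  "(\<And>i. (\<lambda>x. f x i) \<in> borel_measurable M) \<Longrightarrow> (\<lambda>x. max_partial_sum n (f x)) \<in> borel_measurable M"
  by (induction n arbitrary: f) auto

text \<open>A finitely supported substitute for the shift: a sequence read through it begins with
  its terms of index 1 to \<open>n\<close>.\<close>

definition cycle_upto :: "nat \<Rightarrow> nat \<Rightarrow> nat" where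
  "cycle_upto n i = (if i < n then Suc i else if i = n then 0 else i)"

lemma permutation_cycle_upto: "permutation (cycle_upto n)"
proof -
  have "cycle_upto n permutes {..n}"
    by (rule inj_imp_permutes) (auto simp: cycle_upto_def inj_on_def split: if_splits)
  then show ?thesis
    by (rule permutes_imp_permutation[rotated]) simp
qed

text \<open>The support of \<open>p\<close> lies in some initial segment; from there on
  \<open>p\<close> only rearranges the summands.\<close>

lemma sum_permutation_eventually:
  fixes f :: "nat \<Rightarrow> 'b :: comm_monoid_add"
  assumes "permutation p"
  shows "\<forall>\<^sub>F n in sequentially. (\<Sum>i<n. f (p i)) = (\<Sum>i<n. f i)"
proof -
  obtain S where "finite S" and S: "p permutes S"
    using assms by (auto simp: permutation_permutes)
  then obtain N where N: "S \<subseteq> {..<N}"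
    using finite_nat_iff_bounded by blast
  have "(\<Sum>i<n. f (p i)) = (\<Sum>i<n. f i)" if "N \<le> n" for n
  proof -
    have "p permutes {..<n}"
      using N that by (intro permutes_subset[OF S]) auto
    then show ?thesis by (simp add: sum.permute[of p "{..<n}" f] o_def)
  qed
  then show ?thesis unfolding eventually_sequentially by blast
qed

text \<open>A finite permutation changes only finitely many partial sums, so it cannot affect what
  happens infinitely often. This puts the exceptional events of the law of large numbers into the
  invariant field.\<close>

lemma infinitely_often_pos_sums_perm_invariant:
  assumes [measurable]: "\<phi> \<in> borel_measurable borel"
  shows "{x. \<exists>\<^sub>\<infinity>n. 0 < (\<Sum>i<n. \<phi> (x i) :: real)} \<in> perm_invariant_sets"
proof -
  have "{x \<in> space borel_seq. \<forall>m. \<exists>n>m. 0 < (\<Sum>i<n. \<phi> (x i) :: real)} \<in> sets borel_seq"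
    by measurable
  moreover have "(\<exists>\<^sub>\<infinity>n. 0 < (\<Sum>i<n. \<phi> (x (p i)))) \<longleftrightarrow> (\<exists>\<^sub>\<infinity>n. 0 < (\<Sum>i<n. \<phi> (x i)))"
    if "permutation p" for p :: "nat \<Rightarrow> nat" and x
    using sum_permutation_eventually[OF that, of "\<lambda>i. \<phi> (x i)"]
    unfolding cofinite_eq_sequentially[symmetric]
    by (intro iffI; elim frequently_rev_mp) (auto elim: eventually_mono)
  ultimately show ?thesis
    by (auto simp: perm_invariant_sets_def space_borel_seq INFM_nat)
qed

text \<open>Finite rather than probability measures, because the intended law has mass E|\<xi> 0|,
  which may differ from 1.\<close>

locale exchangeable_measure = finite_measure \<mu> for \<mu> :: "(nat \<Rightarrow> real) measure" +
  assumes sets_borel_seq [measurable_cong]: "sets \<mu> = sets borel_seq"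
    and distr_permutation: "permutation p \<Longrightarrow> distr \<mu> borel_seq (\<lambda>x i. x (p i)) = \<mu>"
begin

lemma space_UNIV: "space \<mu> = UNIV"
  using sets_eq_imp_space_eq[OF sets_borel_seq] by (simp add: space_borel_seq)

lemma measurable_permute: "(\<lambda>x i. x (p i)) \<in> measurable \<mu> borel_seq"
  by (intro measurable_PiM_single') (auto simp: space_UNIV)

lemma
  fixes f :: "(nat \<Rightarrow> real) \<Rightarrow> real"
  assumes p: "permutation p" and [measurable]: "f \<in> borel_measurable borel_seq"
  shows integral_permutation: "(\<integral>x. f (\<lambda>i. x (p i)) \<partial>\<mu>) = (\<integral>x. f x \<partial>\<mu>)"
    and integrable_permutation: "integrable \<mu> (\<lambda>x. f (\<lambda>i. x (p i))) \<longleftrightarrow> integrable \<mu> f"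
  using integral_distr[OF measurable_permute, of f p] integrable_distr_eq[OF measurable_permute, of f p]
  by (simp_all add: distr_permutation[OF p])

lemma
  fixes \<phi> :: "real \<Rightarrow> real"
  assumes [measurable]: "\<phi> \<in> borel_measurable borel"
  shows integral_coordinate: "(\<integral>x. \<phi> (x i) \<partial>\<mu>) = (\<integral>x. \<phi> (x 0) \<partial>\<mu>)"
    and integrable_coordinate: "integrable \<mu> (\<lambda>x. \<phi> (x i)) \<longleftrightarrow> integrable \<mu> (\<lambda>x. \<phi> (x 0))"
  using integral_permutation[of "Transposition.transpose 0 i" "\<lambda>x. \<phi> (x 0)"]
    integrable_permutation[of "Transposition.transpose 0 i" "\<lambda>x. \<phi> (x 0)"]
  by (simp_all add: permutation_swap_id)

text \<open>Garsia's argument for the maximal ergodic inequality; the shift is replaced by the cyclic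
  permutation of the first coordinates, because only these enter the maximum.\<close>

lemma maximal_inequality:
  fixes \<phi> :: "real \<Rightarrow> real"
  assumes [measurable]: "\<phi> \<in> borel_measurable borel" and int: "integrable \<mu> (\<lambda>x. \<phi> (x 0))"
    and C: "C \<in> perm_invariant_sets" and pos: "\<And>x. x \<in> C \<Longrightarrow> \<exists>n. 0 < (\<Sum>i<n. \<phi> (x i))"
  shows "0 \<le> (\<integral>x. indicator C x * \<phi> (x 0) \<partial>\<mu>)"
proof -
  have [measurable]: "C \<in> sets borel_seq" using C by (simp add: perm_invariant_sets_def)
  define R where "R n x = max_partial_sum n (\<lambda>i. \<phi> (x i))" for n x
  have R_meas [measurable]: "R n \<in> borel_measurable borel_seq" for n
    unfolding R_def by measurable
  have intR: "integrable \<mu> (\<lambda>x. indicator C x * R n x)" for n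
  proof (rule Bochner_Integration.integrable_bound[of _ "\<lambda>x. \<Sum>i<n. \<bar>\<phi> (x i)\<bar>"])
    show "integrable \<mu> (\<lambda>x. \<Sum>i<n. \<bar>\<phi> (x i)\<bar>)"
      by (intro Bochner_Integration.integrable_sum integrable_abs)
        (rule iffD2[OF integrable_coordinate[OF assms(1)] int])
    show "AE x in \<mu>. norm (indicator C x * R n x) \<le> norm (\<Sum>i<n. \<bar>\<phi> (x i)\<bar>)"
      using max_partial_sum_le[of n] max_partial_sum_nonneg[of n]
      by (intro AE_I2) (auto simp: R_def indicator_def sum_nonneg)
  qed measurable
  have C_perm: "(\<lambda>i. x (p i)) \<in> C \<longleftrightarrow> x \<in> C" if "permutation p" for p x
    using C that by (auto simp: perm_invariant_sets_def)
  have shift: "max_partial_sum n (\<lambda>i. \<phi> (x (Suc i))) = R n (\<lambda>i. x (cycle_upto n i))" for n x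
    unfolding R_def by (rule max_partial_sum_cong) (simp add: cycle_upto_def)
  have "0 \<le> (\<integral>x. indicator C x * \<phi> (x 0) * indicator {x. 0 < R (Suc n) x} x \<partial>\<mu>)" for n
  proof -
    \<comment> \<open>Since \<open>C\<close> is invariant, the cyclic permutation acts on
      \<open>R n\<close> alone, and exchangeability leaves the integral unchanged.\<close>
    have perm: "integrable \<mu> (\<lambda>x. indicator C x * R n (\<lambda>i. x (cycle_upto n i)))"
      "(\<integral>x. indicator C x * R n (\<lambda>i. x (cycle_upto n i)) \<partial>\<mu>) = (\<integral>x. indicator C x * R n x \<partial>\<mu>)"
      using integral_permutation[OF permutation_cycle_upto, of "\<lambda>x. indicator C x * R n x" n]
        integrable_permutation[OF permutation_cycle_upto, of "\<lambda>x. indicator C x * R n x" n] intR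
      by (simp_all add: C_perm[OF permutation_cycle_upto] indicator_def cong: if_cong)
    have "0 \<le> (\<integral>x. indicator C x * R (Suc n) x \<partial>\<mu>) - (\<integral>x. indicator C x * R n x \<partial>\<mu>)"
      using integral_mono[OF intR[of n] intR[of "Suc n"]] max_partial_sum_mono
      by (simp add: R_def indicator_def del: max_partial_sum.simps)
    also have "\<dots> = (\<integral>x. indicator C x * R (Suc n) x - indicator C x * R n (\<lambda>i. x (cycle_upto n i)) \<partial>\<mu>)"
      using perm intR by simp
    \<comment> \<open>Where \<open>R (Suc n) x\<close> is positive, the recursion makes the
      difference equal to \<open>\<phi> (x 0)\<close>; elsewhere the difference is at most
      0.\<close>
    also have "\<dots> \<le> (\<integral>x. indicator C x * \<phi> (x 0) * indicator {x. 0 < R (Suc n) x} x \<partial>\<mu>)"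
    proof (rule integral_mono)
      show "integrable \<mu> (\<lambda>x. indicator C x * \<phi> (x 0) * indicator {x. 0 < R (Suc n) x} x)"
        by (rule Bochner_Integration.integrable_bound[OF int])
          (auto simp: indicator_def space_UNIV intro!: AE_I2)
      fix x
      have "R (Suc n) x = max 0 (\<phi> (x 0) + R n (\<lambda>i. x (cycle_upto n i)))"
        using shift[of n x] by (simp add: R_def)
      moreover have "0 \<le> R n (\<lambda>i. x (cycle_upto n i))"
        by (simp add: R_def max_partial_sum_nonneg)
      ultimately show "indicator C x * R (Suc n) x - indicator C x * R n (\<lambda>i. x (cycle_upto n i))
          \<le> indicator C x * \<phi> (x 0) * indicator {x. 0 < R (Suc n) x} x"
        by (auto simp: indicator_def)
    qed (use perm intR in auto)
    finally show ?thesis .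
  qed
  \<comment> \<open>Each point of \<open>C\<close> has a positive partial sum and \<open>R\<close>
    increases in \<open>n\<close>, so the last indicator is eventually 1 on
    \<open>C\<close>.\<close>
  moreover have "(\<lambda>n. \<integral>x. indicator C x * \<phi> (x 0) * indicator {x. 0 < R (Suc n) x} x \<partial>\<mu>)
      \<longlonglongrightarrow> (\<integral>x. indicator C x * \<phi> (x 0) \<partial>\<mu>)"
  proof (rule integral_dominated_convergence[where w="\<lambda>x. \<bar>\<phi> (x 0)\<bar>"])
    have "\<forall>\<^sub>F n in sequentially. indicator C x * \<phi> (x 0) * indicator {x. 0 < R (Suc n) x} x = indicator C x * \<phi> (x 0)" for x
    proof (cases "x \<in> C")
      case True
      then obtain m where "0 < (\<Sum>i<m. \<phi> (x i))" using pos by blast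
      then have m: "0 < R m x"
        using sum_le_max_partial_sum[of "\<lambda>i. \<phi> (x i)" m] by (simp add: R_def)
      have "incseq (\<lambda>n. R n x)"
        unfolding R_def by (rule incseq_SucI) (rule max_partial_sum_mono)
      with m have "0 < R (Suc n) x" if "m \<le> n" for n
        using that by (meson incseqD le_SucI less_le_trans)
      then show ?thesis by (intro eventually_sequentiallyI[of m]) simp
    qed simp
    then show "AE x in \<mu>. (\<lambda>n. indicator C x * \<phi> (x 0) * indicator {x. 0 < R (Suc n) x} x) \<longlonglongrightarrow> indicator C x * \<phi> (x 0)"
      by (intro AE_I2 tendsto_eventually)
    show "AE x in \<mu>. norm (indicator C x * \<phi> (x 0) * indicator {x. 0 < R (Suc n) x} x) \<le> \<bar>\<phi> (x 0)\<bar>" for n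
      by (auto simp: indicator_def)
  qed (use int in \<open>auto simp: space_UNIV\<close>)
  ultimately show ?thesis
    by (intro LIMSEQ_le_const) auto
qed

end

subsection \<open>The law of large numbers\<close>

text \<open>Weighting \<open>M\<close> by \<open>w\<close> stands for the passage to the measure with density \<open>w\<close>; conditional
  expectations are nevertheless taken with respect to \<open>M\<close>, which is why the limits below are quotients.\<close>

locale weighted_exchangeable = prob_space M for M :: "'a measure" +
  fixes w :: "'a \<Rightarrow> real" and \<zeta> :: "nat \<Rightarrow> 'a \<Rightarrow> real"
  assumes w_integrable: "integrable M w" and w_nonneg: "\<And>\<omega>. 0 \<le> w \<omega>" and w_pos: "AE \<omega> in M. 0 < w \<omega>"
    and \<zeta>_measurable [measurable]: "\<And>i. \<zeta> i \<in> borel_measurable M"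
    and exchangeable: "\<And>p. permutation p \<Longrightarrow>
      distr (density M (\<lambda>\<omega>. ennreal (w \<omega>))) borel_seq (\<lambda>\<omega> i. \<zeta> (p i) \<omega>) =
      distr (density M (\<lambda>\<omega>. ennreal (w \<omega>))) borel_seq (\<lambda>\<omega> i. \<zeta> i \<omega>)"
begin

definition law :: "(nat \<Rightarrow> real) measure" where
  "law = distr (density M (\<lambda>\<omega>. ennreal (w \<omega>))) borel_seq (\<lambda>\<omega> i. \<zeta> i \<omega>)"

definition F :: "'a measure" where "F = perm_invariant_field M \<zeta>"

abbreviation D :: "'a \<Rightarrow> real" where "D \<equiv> real_cond_exp M F w"

text \<open>By Bayes' formula, \<open>G \<phi> / D\<close> is the conditional expectation of
  \<phi>(\<zeta> 0) given \<open>F\<close> under the measure with density \<open>w\<close>.\<close>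

abbreviation G :: "(real \<Rightarrow> real) \<Rightarrow> 'a \<Rightarrow> real" where
  "G \<phi> \<equiv> real_cond_exp M F (\<lambda>\<omega>. w \<omega> * \<phi> (\<zeta> 0 \<omega>))"

lemma w_measurable [measurable]: "w \<in> borel_measurable M"
  using w_integrable by auto

lemma \<zeta>_seq_measurable [measurable]: "(\<lambda>\<omega> i. \<zeta> (p i) \<omega>) \<in> measurable M borel_seq"
  by (intro measurable_PiM_single') auto

sublocale finite_measure_subalgebra M F
  using subalgebra_perm_invariant_field[OF \<zeta>_measurable]
  by (simp add: finite_measure_subalgebra_def finite_measure_subalgebra_axioms_def F_def finite_measure_axioms)

sublocale law: exchangeable_measure law
proof (intro exchangeable_measure.intro exchangeable_measure_axioms.intro)
  have "finite_measure (density M (\<lambda>\<omega>. ennreal (w \<omega>)))"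
    using w_integrable w_nonneg by (intro finite_measureI) (simp add: emeasure_density nn_integral_eq_integral)
  then show "finite_measure law"
    unfolding law_def using \<zeta>_seq_measurable[of "\<lambda>i. i"]
    by (intro finite_measure.finite_measure_distr) auto
  show "sets law = sets borel_seq" by (simp add: law_def)
  fix p :: "nat \<Rightarrow> nat" assume p: "permutation p"
  have "distr law borel_seq (\<lambda>x i. x (p i)) = distr (density M (\<lambda>\<omega>. ennreal (w \<omega>))) borel_seq (\<lambda>\<omega> i. \<zeta> (p i) \<omega>)"
    unfolding law_def
    by (subst distr_distr) (auto simp: o_def intro!: measurable_PiM_single')
  then show "distr law borel_seq (\<lambda>x i. x (p i)) = law"
    unfolding law_def exchangeable[OF p] .
qed

lemma
  fixes f :: "(nat \<Rightarrow> real) \<Rightarrow> real"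
  assumes [measurable]: "f \<in> borel_measurable borel_seq"
  shows integral_law: "(\<integral>x. f x \<partial>law) = (\<integral>\<omega>. w \<omega> * f (\<lambda>i. \<zeta> i \<omega>) \<partial>M)"
    and integrable_law: "integrable law f \<longleftrightarrow> integrable M (\<lambda>\<omega>. w \<omega> * f (\<lambda>i. \<zeta> i \<omega>))"
  using w_nonneg \<zeta>_seq_measurable[of "\<lambda>i. i"]
  by (auto simp: law_def integral_distr integrable_distr_eq integral_density integrable_density)

lemma
  fixes \<phi> :: "real \<Rightarrow> real"
  assumes [measurable]: "\<phi> \<in> borel_measurable borel"
  shows integral_term: "(\<integral>\<omega>. w \<omega> * \<phi> (\<zeta> i \<omega>) \<partial>M) = (\<integral>\<omega>. w \<omega> * \<phi> (\<zeta> 0 \<omega>) \<partial>M)"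
    and integrable_term: "integrable M (\<lambda>\<omega>. w \<omega> * \<phi> (\<zeta> i \<omega>)) \<longleftrightarrow> integrable M (\<lambda>\<omega>. w \<omega> * \<phi> (\<zeta> 0 \<omega>))"
  using law.integral_coordinate[OF assms, of i] law.integrable_coordinate[OF assms, of i]
  by (simp_all add: integral_law integrable_law)

lemma D_pos: "AE \<omega> in M. 0 < D \<omega>"
  by (rule real_cond_exp_gr_c[OF w_integrable w_pos])

lemma weighted_maximal_inequality:
  assumes [measurable]: "\<phi> \<in> borel_measurable borel" and int: "integrable M (\<lambda>\<omega>. w \<omega> * \<phi> (\<zeta> 0 \<omega>))"
    and A: "A \<in> sets F" and pos: "\<And>\<omega>. \<omega> \<in> A \<Longrightarrow> \<exists>\<^sub>\<infinity>n. 0 < (\<Sum>i<n. \<phi> (\<zeta> i \<omega>))"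
  shows "0 \<le> (\<integral>\<omega>. indicator A \<omega> * (w \<omega> * \<phi> (\<zeta> 0 \<omega>)) \<partial>M)"
proof -
  interpret S: sigma_algebra UNIV perm_invariant_sets
    by (rule sigma_algebra_perm_invariant)
  obtain B where B: "B \<in> perm_invariant_sets" "A = {\<omega> \<in> space M. (\<lambda>i. \<zeta> i \<omega>) \<in> B}"
    using A by (auto simp: F_def sets_perm_invariant_field)
  \<comment> \<open>The hypothesis controls \<open>B\<close> only at values of \<zeta>. The
    intersection enforces positive sums at every point of \<open>C\<close> and leaves the preimage
    \<open>A\<close> unchanged.\<close>
  define C where "C = B \<inter> {x. \<exists>\<^sub>\<infinity>n. 0 < (\<Sum>i<n. \<phi> (x i))}"
  have C: "C \<in> perm_invariant_sets"
    unfolding C_def using B infinitely_often_pos_sums_perm_invariant[OF assms(1)] by blast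
  then have [measurable]: "C \<in> sets borel_seq" by (simp add: perm_invariant_sets_def)
  have "0 \<le> (\<integral>x. indicator C x * \<phi> (x 0) \<partial>law)"
    using int C by (intro law.maximal_inequality) (auto simp: integrable_law C_def INFM_nat)
  also have "\<dots> = (\<integral>\<omega>. w \<omega> * (indicator C (\<lambda>i. \<zeta> i \<omega>) * \<phi> (\<zeta> 0 \<omega>)) \<partial>M)"
    by (simp add: integral_law)
  also have "\<dots> = (\<integral>\<omega>. indicator A \<omega> * (w \<omega> * \<phi> (\<zeta> 0 \<omega>)) \<partial>M)"
    using pos by (intro Bochner_Integration.integral_cong) (auto simp: B C_def indicator_def)
  finally show ?thesis .
qed

text \<open>Let \<open>A\<close> be the event where G \<phi> < b D and yet the averages exceed b
  infinitely often. The maximal inequality for \<phi> - b says that G \<phi> - b D has nonnegative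
  integral over \<open>A\<close>, although it is negative there; hence \<open>A\<close> is
  null.\<close>

lemma AE_upper:
  assumes [measurable]: "\<phi> \<in> borel_measurable borel" and int: "integrable M (\<lambda>\<omega>. w \<omega> * \<phi> (\<zeta> 0 \<omega>))"
  shows "AE \<omega> in M. G \<phi> \<omega> < b * D \<omega> \<longrightarrow> (\<forall>\<^sub>F n in sequentially. (\<Sum>i<n. \<phi> (\<zeta> i \<omega>)) \<le> b * n)"
proof -
  define \<psi> where "\<psi> x = \<phi> x - b" for x
  have [measurable]: "\<psi> \<in> borel_measurable borel" unfolding \<psi>_def by measurable
  have sp: "space F = space M" using subalg by (simp add: subalgebra_def)
  define A where "A = {\<omega> \<in> space M. \<exists>\<^sub>\<infinity>n. 0 < (\<Sum>i<n. \<psi> (\<zeta> i \<omega>))} \<inter> {\<omega> \<in> space M. G \<phi> \<omega> < b * D \<omega>}"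
  have "{\<omega> \<in> space M. \<exists>\<^sub>\<infinity>n. 0 < (\<Sum>i<n. \<psi> (\<zeta> i \<omega>))} \<in> sets F"
    unfolding F_def sets_perm_invariant_field
    using infinitely_often_pos_sums_perm_invariant[of \<psi>]
    by (intro CollectI exI[of _ "{x. \<exists>\<^sub>\<infinity>n. 0 < (\<Sum>i<n. \<psi> (x i))}"]) auto
  moreover have "{\<omega> \<in> space F. G \<phi> \<omega> < b * D \<omega>} \<in> sets F"
    by measurable
  ultimately have A: "A \<in> sets F"
    unfolding A_def sp by blast
  then have [measurable]: "A \<in> sets M" using subalg by (auto simp: subalgebra_def)
  have int\<psi>: "integrable M (\<lambda>\<omega>. w \<omega> * \<psi> (\<zeta> 0 \<omega>))"
    using int w_integrable by (simp add: \<psi>_def right_diff_distrib)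
  have intG: "integrable M (\<lambda>\<omega>. indicator A \<omega> * G \<phi> \<omega>)" "integrable M (\<lambda>\<omega>. indicator A \<omega> * D \<omega>)"
    using int w_integrable by (auto intro!: integrable_mult_indicator[where 'b=real, simplified])
  have int': "integrable M (\<lambda>\<omega>. indicator A \<omega> * (w \<omega> * \<phi> (\<zeta> 0 \<omega>)))" "integrable M (\<lambda>\<omega>. indicator A \<omega> * w \<omega>)"
    using int w_integrable by (auto intro!: integrable_mult_indicator[where 'b=real, simplified])
  have gap: "indicator A \<omega> * (b * D \<omega> - G \<phi> \<omega>) = b * (indicator A \<omega> * D \<omega>) - indicator A \<omega> * G \<phi> \<omega>" for \<omega>
    by (simp add: algebra_simps)
  have "0 \<le> (\<integral>\<omega>. indicator A \<omega> * (w \<omega> * \<psi> (\<zeta> 0 \<omega>)) \<partial>M)"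
  proof (rule weighted_maximal_inequality[OF _ int\<psi> A])
    show "\<exists>\<^sub>\<infinity>n. 0 < (\<Sum>i<n. \<psi> (\<zeta> i \<omega>))" if "\<omega> \<in> A" for \<omega> using that by (simp add: A_def)
  qed measurable
  also have "\<dots> = (\<integral>\<omega>. indicator A \<omega> * (w \<omega> * \<phi> (\<zeta> 0 \<omega>)) - b * (indicator A \<omega> * w \<omega>) \<partial>M)"
    by (intro Bochner_Integration.integral_cong) (auto simp: \<psi>_def algebra_simps)
  also have "\<dots> = (\<integral>\<omega>. indicator A \<omega> * (w \<omega> * \<phi> (\<zeta> 0 \<omega>)) \<partial>M) - b * (\<integral>\<omega>. indicator A \<omega> * w \<omega> \<partial>M)"
    using int' by simp
  \<comment> \<open>\<open>A\<close> belongs to \<open>F\<close>, so over \<open>A\<close> the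
    functions and their conditional expectations have the same integrals.\<close>
  also have "\<dots> = (\<integral>\<omega>. indicator A \<omega> * G \<phi> \<omega> \<partial>M) - b * (\<integral>\<omega>. indicator A \<omega> * D \<omega> \<partial>M)"
    using real_cond_exp_intA[OF int A] real_cond_exp_intA[OF w_integrable A]
    by (simp add: set_lebesgue_integral_def)
  also have "\<dots> = - (\<integral>\<omega>. indicator A \<omega> * (b * D \<omega> - G \<phi> \<omega>) \<partial>M)"
    unfolding gap using intG by simp
  finally have le: "(\<integral>\<omega>. indicator A \<omega> * (b * D \<omega> - G \<phi> \<omega>) \<partial>M) \<le> 0" by simp
  have nonneg: "0 \<le> indicator A \<omega> * (b * D \<omega> - G \<phi> \<omega>)" for \<omega>
    by (auto simp: A_def indicator_def)
  have "integrable M (\<lambda>\<omega>. indicator A \<omega> * (b * D \<omega> - G \<phi> \<omega>))"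
    unfolding gap using intG by simp
  then have "AE \<omega> in M. indicator A \<omega> * (b * D \<omega> - G \<phi> \<omega>) = 0"
    using le Bochner_Integration.integral_nonneg[OF nonneg, of M] nonneg
    by (subst integral_nonneg_eq_0_iff_AE[symmetric]) (auto intro: antisym)
  then show ?thesis
  proof (rule AE_mp, intro AE_I2 impI)
    fix \<omega> assume "\<omega> \<in> space M" "indicator A \<omega> * (b * D \<omega> - G \<phi> \<omega>) = 0" "G \<phi> \<omega> < b * D \<omega>"
    then have "\<not> (\<exists>\<^sub>\<infinity>n. 0 < (\<Sum>i<n. \<psi> (\<zeta> i \<omega>)))"
      by (auto simp: A_def indicator_def split: if_splits)
    then show "\<forall>\<^sub>F n in sequentially. (\<Sum>i<n. \<phi> (\<zeta> i \<omega>)) \<le> b * n"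
      by (simp add: not_frequently cofinite_eq_sequentially not_less \<psi>_def sum_subtractf mult.commute)
  qed
qed

text \<open>The one-sided bounds for \<phi> and for its negative squeeze the averages. Rational
  levels suffice and keep the union of the exceptional null sets null.\<close>

lemma AE_averages:
  assumes [measurable]: "\<phi> \<in> borel_measurable borel" and int: "integrable M (\<lambda>\<omega>. w \<omega> * \<phi> (\<zeta> 0 \<omega>))"
  shows "AE \<omega> in M. (\<lambda>n. (\<Sum>i<n. \<phi> (\<zeta> i \<omega>)) / n) \<longlonglongrightarrow> G \<phi> \<omega> / D \<omega>"
proof -
  have "AE \<omega> in M. \<forall>q :: rat. G \<phi> \<omega> < of_rat q * D \<omega> \<longrightarrow>
      (\<forall>\<^sub>F n in sequentially. (\<Sum>i<n. \<phi> (\<zeta> i \<omega>)) \<le> of_rat q * n)"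
    unfolding AE_all_countable by (intro allI AE_upper int) measurable
  moreover have "AE \<omega> in M. \<forall>q :: rat. G (\<lambda>x. - \<phi> x) \<omega> < of_rat q * D \<omega> \<longrightarrow>
      (\<forall>\<^sub>F n in sequentially. (\<Sum>i<n. - \<phi> (\<zeta> i \<omega>)) \<le> of_rat q * n)"
    unfolding AE_all_countable using int by (intro allI AE_upper) auto
  moreover have "AE \<omega> in M. G (\<lambda>x. - \<phi> x) \<omega> = - G \<phi> \<omega>"
    using real_cond_exp_cmult[OF int, of "-1"] by simp
  ultimately show ?thesis
    using D_pos
  proof eventually_elim
    case (elim \<omega>)
    show ?case
    proof (rule order_tendstoI)
      fix a assume "a < G \<phi> \<omega> / D \<omega>"
      then obtain q :: rat where q: "a < of_rat q" "of_rat q < G \<phi> \<omega> / D \<omega>"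
        using of_rat_dense by blast
      then have "G (\<lambda>x. - \<phi> x) \<omega> < of_rat (- q) * D \<omega>"
        using elim(3,4) by (simp add: pos_less_divide_eq of_rat_minus)
      then have "\<forall>\<^sub>F n in sequentially. (\<Sum>i<n. - \<phi> (\<zeta> i \<omega>)) \<le> of_rat (- q) * n"
        using elim(2) by blast
      then show "\<forall>\<^sub>F n in sequentially. a < (\<Sum>i<n. \<phi> (\<zeta> i \<omega>)) / n"
        using eventually_gt_at_top[of 0]
      proof eventually_elim
        case (elim n)
        then have "of_rat q * n \<le> (\<Sum>i<n. \<phi> (\<zeta> i \<omega>))" by (simp add: sum_negf of_rat_minus)
        moreover have "a * n < of_rat q * n" using q elim by simp
        ultimately have "a * n < (\<Sum>i<n. \<phi> (\<zeta> i \<omega>))" by linarith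
        then show ?case using elim by (simp add: pos_less_divide_eq)
      qed
    next
      fix a assume "G \<phi> \<omega> / D \<omega> < a"
      then obtain q :: rat where q: "G \<phi> \<omega> / D \<omega> < of_rat q" "of_rat q < a"
        using of_rat_dense by blast
      then have "G \<phi> \<omega> < of_rat q * D \<omega>"
        using elim(4) by (simp add: pos_divide_less_eq)
      then have "\<forall>\<^sub>F n in sequentially. (\<Sum>i<n. \<phi> (\<zeta> i \<omega>)) \<le> of_rat q * n"
        using elim(1) by blast
      then show "\<forall>\<^sub>F n in sequentially. (\<Sum>i<n. \<phi> (\<zeta> i \<omega>)) / n < a"
        using eventually_gt_at_top[of 0]
      proof eventually_elim
        case (elim n)
        moreover have "of_rat q * n < a * n" using q elim by simp
        ultimately have "(\<Sum>i<n. \<phi> (\<zeta> i \<omega>)) < a * n" by linarith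
        then show ?case using elim by (simp add: pos_divide_less_eq)
      qed
    qed
  qed
qed

lemma
  assumes [measurable]: "\<phi> \<in> borel_measurable borel" and int: "integrable M (\<lambda>\<omega>. w \<omega> * \<phi> (\<zeta> 0 \<omega>))"
  shows integrable_weighted_sum: "integrable M (\<lambda>\<omega>. w \<omega> * (\<Sum>i<n. \<phi> (\<zeta> i \<omega>)))"
    and integral_weighted_sum: "(\<integral>\<omega>. w \<omega> * (\<Sum>i<n. \<phi> (\<zeta> i \<omega>)) \<partial>M) = n * (\<integral>\<omega>. w \<omega> * \<phi> (\<zeta> 0 \<omega>) \<partial>M)"
proof -
  have ints: "integrable M (\<lambda>\<omega>. w \<omega> * \<phi> (\<zeta> i \<omega>))" for i
    by (rule iffD2[OF integrable_term[OF assms(1)] int])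
  show "integrable M (\<lambda>\<omega>. w \<omega> * (\<Sum>i<n. \<phi> (\<zeta> i \<omega>)))"
    unfolding sum_distrib_left by (rule Bochner_Integration.integrable_sum[OF ints])
  have "(\<integral>\<omega>. w \<omega> * (\<Sum>i<n. \<phi> (\<zeta> i \<omega>)) \<partial>M) = (\<Sum>i<n. \<integral>\<omega>. w \<omega> * \<phi> (\<zeta> i \<omega>) \<partial>M)"
    unfolding sum_distrib_left by (rule Bochner_Integration.integral_sum[OF ints])
  also have "\<dots> = (\<Sum>i<n. \<integral>\<omega>. w \<omega> * \<phi> (\<zeta> 0 \<omega>) \<partial>M)"
    by (intro sum.cong refl integral_term[OF assms(1)])
  finally show "(\<integral>\<omega>. w \<omega> * (\<Sum>i<n. \<phi> (\<zeta> i \<omega>)) \<partial>M) = n * (\<integral>\<omega>. w \<omega> * \<phi> (\<zeta> 0 \<omega>) \<partial>M)"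
    by simp
qed

section \<open>Convergence in mean of the weighted averages\<close>

text \<open>All averages have integral at most K. Fatou's lemma makes the limit integrable,
  conditioning shows that its integral is exactly K, and Scheffe's lemma then upgrades almost sure
  convergence.\<close>

lemma averages_L1_nonneg:
  assumes [measurable]: "\<phi> \<in> borel_measurable borel" and int: "integrable M (\<lambda>\<omega>. w \<omega> * \<phi> (\<zeta> 0 \<omega>))"
    and nonneg: "\<And>x. 0 \<le> \<phi> x"
  shows "integrable M (\<lambda>\<omega>. w \<omega> * (G \<phi> \<omega> / D \<omega>))"
    and "(\<lambda>n. \<integral>\<omega>. \<bar>w \<omega> * (\<Sum>i<n. \<phi> (\<zeta> i \<omega>)) / n - w \<omega> * (G \<phi> \<omega> / D \<omega>)\<bar> \<partial>M) \<longlonglongrightarrow> 0"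
proof -
  define T where "T n \<omega> = w \<omega> * (\<Sum>i<n. \<phi> (\<zeta> i \<omega>)) / n" for n \<omega>
  define g where "g \<omega> = w \<omega> * (G \<phi> \<omega> / D \<omega>)" for \<omega>
  define K where "K = (\<integral>\<omega>. w \<omega> * \<phi> (\<zeta> 0 \<omega>) \<partial>M)"
  have [measurable]: "T n \<in> borel_measurable M" "g \<in> borel_measurable M" for n
    unfolding T_def g_def by measurable
  have "0 \<le> K" unfolding K_def using nonneg w_nonneg by (intro Bochner_Integration.integral_nonneg) simp
  have T_int: "integrable M (T n)" for n
    unfolding T_def using integrable_weighted_sum[OF assms(1,2), of n] by simp
  have T_nonneg: "0 \<le> T n \<omega>" for n \<omega>
    unfolding T_def using nonneg w_nonneg by (simp add: sum_nonneg)
  \<comment> \<open>An equality for positive \<open>n\<close>; at \<open>n = 0\<close> division by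
    zero makes \<open>T 0\<close> vanish, and \<open>0 \<le> K\<close> is what remains.\<close>
  have "(\<integral>\<omega>. T n \<omega> \<partial>M) \<le> K" for n
    unfolding T_def using integral_weighted_sum[OF assms(1,2), of n] \<open>0 \<le> K\<close> by (simp add: K_def)
  then have T_le: "(\<integral>\<^sup>+\<omega>. ennreal (T n \<omega>) \<partial>M) \<le> ennreal K" for n
    using T_nonneg by (subst nn_integral_eq_integral[OF T_int]) (auto intro: ennreal_leI)
  have T_lim: "AE \<omega> in M. (\<lambda>n. T n \<omega>) \<longlonglongrightarrow> g \<omega>"
    using AE_averages[OF assms(1,2)]
  proof eventually_elim
    case (elim \<omega>)
    from tendsto_mult_left[OF this, of "w \<omega>"] show ?case by (simp add: T_def g_def)
  qed
  have g_nonneg: "AE \<omega> in M. 0 \<le> g \<omega>"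
    using T_lim by eventually_elim (rule LIMSEQ_le_const, auto simp: T_nonneg)
  have "(\<integral>\<^sup>+\<omega>. ennreal (g \<omega>) \<partial>M) = (\<integral>\<^sup>+\<omega>. liminf (\<lambda>n. ennreal (T n \<omega>)) \<partial>M)"
  proof (rule nn_integral_cong_AE)
    show "AE \<omega> in M. ennreal (g \<omega>) = liminf (\<lambda>n. ennreal (T n \<omega>))"
      using T_lim by eventually_elim (rule lim_imp_Liminf[symmetric], auto intro: tendsto_ennrealI)
  qed
  also have "\<dots> \<le> liminf (\<lambda>n. \<integral>\<^sup>+\<omega>. ennreal (T n \<omega>) \<partial>M)"
    by (rule nn_integral_liminf) measurable
  also have "\<dots> \<le> ennreal K"
    using T_le by (intro Liminf_le) (auto intro!: always_eventually)
  finally have "(\<integral>\<^sup>+\<omega>. ennreal (g \<omega>) \<partial>M) < \<infinity>"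
    by (simp add: le_less_trans[OF _ ennreal_less_top])
  then have g_int: "integrable M g"
    using g_nonneg by (intro integrableI_nonneg) auto
  then have gw: "integrable M (\<lambda>\<omega>. G \<phi> \<omega> / D \<omega> * w \<omega>)"
    unfolding g_def[abs_def] by (simp add: mult.commute)
  have "K = (\<integral>\<omega>. G \<phi> \<omega> \<partial>M)"
    unfolding K_def by (rule real_cond_exp_int(2)[OF int, symmetric])
  \<comment> \<open>Introducing \<open>D\<close> is possible since it is almost surely positive. As
    G \<phi> / D is measurable for \<open>F\<close>, the conditional expectation \<open>D\<close>
    may next be exchanged for \<open>w\<close> itself.\<close>
  also have "\<dots> = (\<integral>\<omega>. G \<phi> \<omega> / D \<omega> * D \<omega> \<partial>M)"
    using D_pos by (intro integral_cong_AE) (auto elim!: eventually_mono)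
  also have "\<dots> = (\<integral>\<omega>. g \<omega> \<partial>M)"
    using real_cond_exp_intg(2)[OF gw] by (simp add: g_def mult.commute)
  finally have "ennreal K = (\<integral>\<^sup>+\<omega>. ennreal (g \<omega>) \<partial>M)"
    using nn_integral_eq_integral[OF g_int g_nonneg] by simp
  also have "\<dots> = (\<integral>\<^sup>+\<omega>. ennreal (norm (g \<omega>)) \<partial>M)"
    using g_nonneg by (intro nn_integral_cong_AE) auto
  finally have "(\<integral>\<^sup>+\<omega>. ennreal (norm (T n \<omega>)) \<partial>M) \<le> (\<integral>\<^sup>+\<omega>. ennreal (norm (g \<omega>)) \<partial>M)" for n
    using T_le[of n] by (simp add: T_nonneg)
  then have "(\<lambda>n. \<integral>\<^sup>+\<omega>. ennreal (norm (T n \<omega> - g \<omega>)) \<partial>M) \<longlonglongrightarrow> 0"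
    by (intro Scheffe_lemma2 g_int T_lim) measurable
  moreover have "(\<integral>\<^sup>+\<omega>. ennreal (norm (T n \<omega> - g \<omega>)) \<partial>M) = ennreal (\<integral>\<omega>. \<bar>T n \<omega> - g \<omega>\<bar> \<partial>M)" for n
    using T_int g_int by (subst nn_integral_eq_integral) auto
  ultimately have "(\<lambda>n. \<integral>\<omega>. \<bar>T n \<omega> - g \<omega>\<bar> \<partial>M) \<longlonglongrightarrow> 0"
    using tendsto_ennreal_iff[of "\<lambda>n. \<integral>\<omega>. \<bar>T n \<omega> - g \<omega>\<bar> \<partial>M" sequentially 0] by simp
  then show "(\<lambda>n. \<integral>\<omega>. \<bar>w \<omega> * (\<Sum>i<n. \<phi> (\<zeta> i \<omega>)) / n - w \<omega> * (G \<phi> \<omega> / D \<omega>)\<bar> \<partial>M) \<longlonglongrightarrow> 0"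
    by (simp add: T_def g_def)
  show "integrable M (\<lambda>\<omega>. w \<omega> * (G \<phi> \<omega> / D \<omega>))"
    using g_int by (simp add: g_def[abs_def])
qed

text \<open>Positive and negative parts inherit weighted integrability from \<phi>. Conditional
  expectation is additive almost everywhere, so the triangle inequality reduces the claim to the
  nonnegative case.\<close>

lemma averages_L1:
  assumes [measurable]: "\<phi> \<in> borel_measurable borel" and int: "integrable M (\<lambda>\<omega>. w \<omega> * \<phi> (\<zeta> 0 \<omega>))"
  shows "integrable M (\<lambda>\<omega>. w \<omega> * (G \<phi> \<omega> / D \<omega>))"
    and "(\<lambda>n. \<integral>\<omega>. \<bar>w \<omega> * (\<Sum>i<n. \<phi> (\<zeta> i \<omega>)) / n - w \<omega> * (G \<phi> \<omega> / D \<omega>)\<bar> \<partial>M) \<longlonglongrightarrow> 0"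
proof -
  define g where "g \<psi> \<omega> = w \<omega> * (G \<psi> \<omega> / D \<omega>)" for \<psi> \<omega>
  define T where "T \<psi> n \<omega> = w \<omega> * (\<Sum>i<n. \<psi> (\<zeta> i \<omega>)) / n" for \<psi> :: "real \<Rightarrow> real" and n \<omega>
  define P where "P x = max 0 (\<phi> x)" for x
  define N where "N x = max 0 (- \<phi> x)" for x
  have [measurable]: "P \<in> borel_measurable borel" "N \<in> borel_measurable borel"
    unfolding P_def N_def by measurable
  have [measurable]: "g \<psi> \<in> borel_measurable M" for \<psi>
    unfolding g_def by measurable
  have PN: "0 \<le> P x" "0 \<le> N x" "\<phi> x = P x - N x" "\<bar>P x\<bar> \<le> \<bar>\<phi> x\<bar>" "\<bar>N x\<bar> \<le> \<bar>\<phi> x\<bar>" for x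
    by (auto simp: P_def N_def)
  have int_PN: "integrable M (\<lambda>\<omega>. w \<omega> * P (\<zeta> 0 \<omega>))" "integrable M (\<lambda>\<omega>. w \<omega> * N (\<zeta> 0 \<omega>))"
    by (rule Bochner_Integration.integrable_bound[OF int], measurable,
        use PN(4,5) w_nonneg in \<open>auto simp: abs_mult intro!: AE_I2 mult_left_mono\<close>)+
  have g_int: "integrable M (g P)" "integrable M (g N)"
    and lim: "(\<lambda>n. \<integral>\<omega>. \<bar>T P n \<omega> - g P \<omega>\<bar> \<partial>M) \<longlonglongrightarrow> 0" "(\<lambda>n. \<integral>\<omega>. \<bar>T N n \<omega> - g N \<omega>\<bar> \<partial>M) \<longlonglongrightarrow> 0"
    unfolding g_def[abs_def] T_def
    by (intro averages_L1_nonneg int_PN PN; measurable)+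
  have "AE \<omega> in M. G \<phi> \<omega> = G P \<omega> - G N \<omega>"
    using real_cond_exp_diff[OF int_PN] by (simp add: PN(3) right_diff_distrib)
  then have g_eq: "AE \<omega> in M. g \<phi> \<omega> = g P \<omega> - g N \<omega>"
    by eventually_elim (simp add: g_def diff_divide_distrib right_diff_distrib)
  have "integrable M (g \<phi>)"
    using g_int by (subst integrable_cong_AE[OF _ _ g_eq]) auto
  then show "integrable M (\<lambda>\<omega>. w \<omega> * (G \<phi> \<omega> / D \<omega>))"
    by (simp add: g_def[abs_def])
  have T_int: "integrable M (T \<psi> n)" if "\<psi> \<in> borel_measurable borel" "integrable M (\<lambda>\<omega>. w \<omega> * \<psi> (\<zeta> 0 \<omega>))" for \<psi> n
    unfolding T_def using integrable_weighted_sum[OF that, of n] by simp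
  have "(\<lambda>n. \<integral>\<omega>. \<bar>T \<phi> n \<omega> - g \<phi> \<omega>\<bar> \<partial>M) \<longlonglongrightarrow> 0"
  proof (rule tendsto_sandwich[OF _ _ tendsto_const])
    show "\<forall>\<^sub>F n in sequentially. 0 \<le> (\<integral>\<omega>. \<bar>T \<phi> n \<omega> - g \<phi> \<omega>\<bar> \<partial>M)"
      by (simp add: Bochner_Integration.integral_nonneg)
    have "(\<integral>\<omega>. \<bar>T \<phi> n \<omega> - g \<phi> \<omega>\<bar> \<partial>M)
        \<le> (\<integral>\<omega>. \<bar>T P n \<omega> - g P \<omega>\<bar> \<partial>M) + (\<integral>\<omega>. \<bar>T N n \<omega> - g N \<omega>\<bar> \<partial>M)" for n
    proof -
      have ints: "integrable M (\<lambda>\<omega>. \<bar>T \<phi> n \<omega> - g \<phi> \<omega>\<bar>)" "integrable M (\<lambda>\<omega>. \<bar>T P n \<omega> - g P \<omega>\<bar>)"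
          "integrable M (\<lambda>\<omega>. \<bar>T N n \<omega> - g N \<omega>\<bar>)"
        by (intro integrable_abs Bochner_Integration.integrable_diff T_int int int_PN g_int \<open>integrable M (g \<phi>)\<close>; measurable)+
      have "T \<phi> n \<omega> = T P n \<omega> - T N n \<omega>" for \<omega>
        by (simp add: T_def PN(3) sum_subtractf right_diff_distrib diff_divide_distrib)
      then have "AE \<omega> in M. \<bar>T \<phi> n \<omega> - g \<phi> \<omega>\<bar> \<le> \<bar>T P n \<omega> - g P \<omega>\<bar> + \<bar>T N n \<omega> - g N \<omega>\<bar>"
        using g_eq by (auto elim!: eventually_mono)
      then have "(\<integral>\<omega>. \<bar>T \<phi> n \<omega> - g \<phi> \<omega>\<bar> \<partial>M) \<le> (\<integral>\<omega>. \<bar>T P n \<omega> - g P \<omega>\<bar> + \<bar>T N n \<omega> - g N \<omega>\<bar> \<partial>M)"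
        using ints by (intro integral_mono_AE) auto
      then show ?thesis using ints by simp
    qed
    then show "\<forall>\<^sub>F n in sequentially. (\<integral>\<omega>. \<bar>T \<phi> n \<omega> - g \<phi> \<omega>\<bar> \<partial>M)
        \<le> (\<integral>\<omega>. \<bar>T P n \<omega> - g P \<omega>\<bar> \<partial>M) + (\<integral>\<omega>. \<bar>T N n \<omega> - g N \<omega>\<bar> \<partial>M)"
      by simp
    show "(\<lambda>n. (\<integral>\<omega>. \<bar>T P n \<omega> - g P \<omega>\<bar> \<partial>M) + (\<integral>\<omega>. \<bar>T N n \<omega> - g N \<omega>\<bar> \<partial>M)) \<longlonglongrightarrow> 0"
      using tendsto_add[OF lim] by simp
  qed
  then show "(\<lambda>n. \<integral>\<omega>. \<bar>w \<omega> * (\<Sum>i<n. \<phi> (\<zeta> i \<omega>)) / n - w \<omega> * (G \<phi> \<omega> / D \<omega>)\<bar> \<partial>M) \<longlonglongrightarrow> 0"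
    by (simp add: T_def g_def)
qed

end

subsection \<open>Swap-invariant sequences\<close>

lemma swap_invariant_abs_moment:
  fixes \<xi> :: "nat \<Rightarrow> 'a \<Rightarrow> real"
  assumes "swap_invariant M \<xi>" and p: "p permutes {..<n}"
  shows "(\<integral>\<omega>. \<bar>t * \<xi> 0 \<omega> + (\<Sum>j<n. v j * \<xi> (Suc (p j)) \<omega>)\<bar> \<partial>M)
       = (\<integral>\<omega>. \<bar>t * \<xi> 0 \<omega> + (\<Sum>j<n. v j * \<xi> (Suc j) \<omega>)\<bar> \<partial>M)"
proof -
  \<comment> \<open>Index 0 stays fixed because that variable is to become the density;
    \<open>p\<close> acts on the remaining indices, moved up by one.\<close>
  define q where "q i = (case i of 0 \<Rightarrow> 0 | Suc j \<Rightarrow> Suc (p j))" for i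
  have "q permutes {..<Suc n}"
  proof (rule inj_imp_permutes)
    show "inj_on q {..<Suc n}"
      by (auto simp: q_def inj_on_def inj_eq[OF permutes_inj[OF p]] split: nat.splits)
    show "q i \<in> {..<Suc n}" if "i \<in> {..<Suc n}" for i
      using that permutes_in_image[OF p] by (auto simp: q_def split: nat.splits)
    show "q i = i" if "i \<notin> {..<Suc n}" for i
      using that permutes_not_in[OF p] by (auto simp: q_def split: nat.splits)
  qed simp
  moreover have "swap_invariant_vector M (Suc n) (\<lambda>i. \<xi> (id i))"
    using assms(1) by (simp add: swap_invariant_def strict_mono_on_def)
  ultimately have "zonoid_equivalent (Suc n) M (\<lambda>i. \<xi> (id (q i))) M (\<lambda>i. \<xi> (id (id i)))"
    unfolding swap_invariant_vector_def using permutes_id by blast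
  then have "(\<integral>\<omega>. \<bar>\<Sum>i<Suc n. (case i of 0 \<Rightarrow> t | Suc j \<Rightarrow> v j) * \<xi> (q i) \<omega>\<bar> \<partial>M)
      = (\<integral>\<omega>. \<bar>\<Sum>i<Suc n. (case i of 0 \<Rightarrow> t | Suc j \<Rightarrow> v j) * \<xi> i \<omega>\<bar> \<partial>M)"
    unfolding zonoid_equivalent_def by simp
  then show ?thesis
    by (simp add: sum.lessThan_Suc_shift q_def del: sum.lessThan_Suc)
qed

text \<open>Under the density \<open>\<bar>\<xi>\<^sub>0\<bar>\<close> the absolute moments \<open>E \<bar>t \<xi>\<^sub>0 + \<Sum> v\<^sub>j \<xi>\<^sub>j\<bar>\<close> become
  \<open>E \<bar>t + \<Sum> v\<^sub>j \<xi>\<^sub>j / \<xi>\<^sub>0\<bar>\<close>; all \<open>t\<close> together determine the law of the linear form.\<close>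

lemma swap_invariant_cos_integral:
  fixes \<xi> :: "nat \<Rightarrow> 'a \<Rightarrow> real"
  assumes swap: "swap_invariant M \<xi>" and nz: "AE \<omega> in M. \<xi> 0 \<omega> \<noteq> 0"
    and p: "p permutes {..<n}"
  shows "(\<integral>\<omega>. \<bar>\<xi> 0 \<omega>\<bar> * cos (\<Sum>j<n. v j * (\<xi> (Suc (p j)) \<omega> / \<xi> 0 \<omega>)) \<partial>M)
       = (\<integral>\<omega>. \<bar>\<xi> 0 \<omega>\<bar> * cos (\<Sum>j<n. v j * (\<xi> (Suc j) \<omega> / \<xi> 0 \<omega>)) \<partial>M)"
proof -
  have int [simp]: "integrable M (\<xi> i)" for i
    using swap by (simp add: swap_invariant_def)
  note [measurable] = borel_measurable_integrable[OF int]
  define N where "N = density M (\<lambda>\<omega>. ennreal \<bar>\<xi> 0 \<omega>\<bar>)"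
  define Y where "Y s \<omega> = (\<Sum>j<n. v j * (\<xi> (Suc (s j)) \<omega> / \<xi> 0 \<omega>))" for s and \<omega>
  have Y_meas [measurable]: "Y s \<in> borel_measurable M" for s
    unfolding Y_def by measurable
  have "finite_measure N"
    unfolding N_def by (intro finite_measureI) (simp add: emeasure_density nn_integral_eq_integral)
  have intN: "(\<integral>\<omega>. f \<omega> \<partial>N) = (\<integral>\<omega>. \<bar>\<xi> 0 \<omega>\<bar> * f \<omega> \<partial>M)" if [measurable]: "f \<in> borel_measurable M" for f :: "'a \<Rightarrow> real"
    unfolding N_def by (simp add: integral_density)
  have scale: "\<bar>\<xi> 0 \<omega>\<bar> * \<bar>t + Y s \<omega>\<bar> = \<bar>t * \<xi> 0 \<omega> + (\<Sum>j<n. v j * \<xi> (Suc (s j)) \<omega>)\<bar>"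
    if "\<xi> 0 \<omega> \<noteq> 0" for t s \<omega>
  proof -
    have "\<xi> 0 \<omega> * Y s \<omega> = (\<Sum>j<n. v j * \<xi> (Suc (s j)) \<omega>)"
      using that by (simp add: Y_def sum_distrib_left)
    then show ?thesis
      by (simp add: distrib_left mult.commute flip: abs_mult)
  qed
  have moment: "(\<integral>\<omega>. \<bar>t + Y s \<omega>\<bar> \<partial>N) = (\<integral>\<omega>. \<bar>t * \<xi> 0 \<omega> + (\<Sum>j<n. v j * \<xi> (Suc (s j)) \<omega>)\<bar> \<partial>M)" for t s
  proof -
    have "(\<integral>\<omega>. \<bar>t + Y s \<omega>\<bar> \<partial>N) = (\<integral>\<omega>. \<bar>\<xi> 0 \<omega>\<bar> * \<bar>t + Y s \<omega>\<bar> \<partial>M)"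
      by (rule intN) measurable
    also have "\<dots> = (\<integral>\<omega>. \<bar>t * \<xi> 0 \<omega> + (\<Sum>j<n. v j * \<xi> (Suc (s j)) \<omega>)\<bar> \<partial>M)"
      by (intro integral_cong_AE eventually_mono[OF nz] scale) measurable
    finally show ?thesis .
  qed
  \<comment> \<open>Under \<open>N\<close> the ratios are integrable because the density cancels
    their denominator, leaving a linear combination of integrable terms.\<close>
  have intY: "integrable N (Y s)" for s
  proof -
    have "AE \<omega> in M. \<xi> 0 \<omega> * Y s \<omega> = (\<Sum>j<n. v j * \<xi> (Suc (s j)) \<omega>)"
      using nz by eventually_elim (simp add: Y_def sum_distrib_left)
    moreover have "integrable M (\<lambda>\<omega>. \<Sum>j<n. v j * \<xi> (Suc (s j)) \<omega>)" by simp
    ultimately have "integrable M (\<lambda>\<omega>. \<xi> 0 \<omega> * Y s \<omega>)"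
      by (subst integrable_cong_AE) auto
    then have "integrable M (\<lambda>\<omega>. \<bar>\<xi> 0 \<omega>\<bar> * Y s \<omega>)"
      by (rule Bochner_Integration.integrable_bound) (auto simp: abs_mult)
    then show ?thesis unfolding N_def by (simp add: integrable_density)
  qed
  have "distr N borel (Y p) = distr N borel (Y id)"
    using \<open>finite_measure N\<close> intY intY
    by (rule distr_eq_of_abs_moments) (simp add: moment swap_invariant_abs_moment[OF swap p])
  moreover have "(\<integral>x. cos x \<partial>distr N borel (Y s)) = (\<integral>\<omega>. \<bar>\<xi> 0 \<omega>\<bar> * cos (Y s \<omega>) \<partial>M)" for s
    using Y_meas[of s] by (subst integral_distr) (auto simp: N_def integral_density)
  ultimately have "(\<integral>\<omega>. \<bar>\<xi> 0 \<omega>\<bar> * cos (Y p \<omega>) \<partial>M) = (\<integral>\<omega>. \<bar>\<xi> 0 \<omega>\<bar> * cos (Y id \<omega>) \<partial>M)"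
    by metis
  then show ?thesis
    by (simp only: Y_def id_apply)
qed

text \<open>Symmetry removes the sine part, so that the phase \<open>a\<close> and the sign of \<open>\<xi>\<^sub>0\<close> factor out.\<close>

lemma symmetric_cos_integral:
  fixes \<xi> :: "nat \<Rightarrow> 'a \<Rightarrow> real"
  assumes int: "\<And>i. integrable M (\<xi> i)" and sym: "symmetric_seq M \<xi>"
  shows "(\<integral>\<omega>. \<bar>\<xi> 0 \<omega>\<bar> * cos ((\<Sum>j<n. v j * (\<xi> (s j) \<omega> / \<bar>\<xi> 0 \<omega>\<bar>)) + a) \<partial>M)
       = cos a * (\<integral>\<omega>. \<bar>\<xi> 0 \<omega>\<bar> * cos (\<Sum>j<n. v j * (\<xi> (s j) \<omega> / \<xi> 0 \<omega>)) \<partial>M)"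
proof -
  note [measurable] = borel_measurable_integrable[OF int]
  define S where "S x = (\<Sum>j<n. v j * (x (s j) / \<bar>x 0\<bar>))" for x :: "nat \<Rightarrow> real"
  have [measurable]: "S \<in> borel_measurable borel_seq"
    unfolding S_def by measurable
  have m: "(\<lambda>\<omega> i. \<xi> i \<omega>) \<in> measurable M borel_seq" "(\<lambda>\<omega> i. - \<xi> i \<omega>) \<in> measurable M borel_seq"
    by (intro measurable_PiM_single'; simp)+
  have S_meas: "(\<lambda>\<omega>. S (\<lambda>i. \<xi> i \<omega>)) \<in> borel_measurable M"
    using measurable_compose[OF m(1), of S] by simp
  have bounded: "integrable M (\<lambda>\<omega>. \<bar>\<xi> 0 \<omega>\<bar> * f \<omega>)"
    if "f \<in> borel_measurable M" "\<And>\<omega>. \<bar>f \<omega>\<bar> \<le> 1" for f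
    by (rule Bochner_Integration.integrable_bound[OF int[of 0]])
      (use that in \<open>auto simp: abs_mult intro!: AE_I2 mult_left_le\<close>)
  \<comment> \<open>Changing the sign of the whole sequence preserves its law and |\<xi> 0| but
    reverses \<open>S\<close>, so this integral equals its own negative.\<close>
  have "(\<integral>\<omega>. \<bar>\<xi> 0 \<omega>\<bar> * sin (S (\<lambda>i. \<xi> i \<omega>)) \<partial>M)
      = (\<integral>x. \<bar>x 0\<bar> * sin (S x) \<partial>distr M borel_seq (\<lambda>\<omega> i. \<xi> i \<omega>))"
    by (rule integral_distr[symmetric, OF m(1)]) measurable
  also have "\<dots> = (\<integral>x. \<bar>x 0\<bar> * sin (S x) \<partial>distr M borel_seq (\<lambda>\<omega> i. - \<xi> i \<omega>))"
    using sym by (simp add: symmetric_seq_def)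
  also have "\<dots> = (\<integral>\<omega>. \<bar>- \<xi> 0 \<omega>\<bar> * sin (S (\<lambda>i. - \<xi> i \<omega>)) \<partial>M)"
    by (rule integral_distr[OF m(2)]) measurable
  also have "\<dots> = - (\<integral>\<omega>. \<bar>\<xi> 0 \<omega>\<bar> * sin (S (\<lambda>i. \<xi> i \<omega>)) \<partial>M)"
    by (simp add: S_def sum_negf)
  finally have sin0: "(\<integral>\<omega>. \<bar>\<xi> 0 \<omega>\<bar> * sin (S (\<lambda>i. \<xi> i \<omega>)) \<partial>M) = 0" by simp
  have "\<bar>\<xi> 0 \<omega>\<bar> * cos (S (\<lambda>i. \<xi> i \<omega>) + a)
      = cos a * (\<bar>\<xi> 0 \<omega>\<bar> * cos (S (\<lambda>i. \<xi> i \<omega>))) - sin a * (\<bar>\<xi> 0 \<omega>\<bar> * sin (S (\<lambda>i. \<xi> i \<omega>)))" for \<omega>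
    by (simp add: cos_add algebra_simps)
  then have "(\<integral>\<omega>. \<bar>\<xi> 0 \<omega>\<bar> * cos (S (\<lambda>i. \<xi> i \<omega>) + a) \<partial>M)
      = cos a * (\<integral>\<omega>. \<bar>\<xi> 0 \<omega>\<bar> * cos (S (\<lambda>i. \<xi> i \<omega>)) \<partial>M) - sin a * (\<integral>\<omega>. \<bar>\<xi> 0 \<omega>\<bar> * sin (S (\<lambda>i. \<xi> i \<omega>)) \<partial>M)"
    using bounded[of "\<lambda>\<omega>. cos (S (\<lambda>i. \<xi> i \<omega>))"] bounded[of "\<lambda>\<omega>. sin (S (\<lambda>i. \<xi> i \<omega>))"] S_meas by simp
  \<comment> \<open>Dividing by \<xi> 0 instead of |\<xi> 0| at most flips the sign of the linear
    form, and cosine is even.\<close>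
  moreover have "cos (S (\<lambda>i. \<xi> i \<omega>)) = cos (\<Sum>j<n. v j * (\<xi> (s j) \<omega> / \<xi> 0 \<omega>))" for \<omega>
    by (cases "0 \<le> \<xi> 0 \<omega>") (simp_all add: S_def sum_negf)
  ultimately show ?thesis
    using sin0 by (simp add: S_def)
qed

text \<open>Symmetry reduces the cosine integrals of the ratios over |\<xi> 0| to those over \<xi>
  0, where swap-invariance removes the permutation. \<open>measure_eq_of_cos\<close> passes from
  these integrals to the laws.\<close>

lemma swap_invariant_imp_weighted_exchangeable:
  assumes "prob_space M" and swap: "swap_invariant M \<xi>" and sym: "symmetric_seq M \<xi>"
    and nz: "AE \<omega> in M. \<xi> 0 \<omega> \<noteq> 0"
  shows "weighted_exchangeable M (\<lambda>\<omega>. \<bar>\<xi> 0 \<omega>\<bar>) (\<lambda>i \<omega>. \<xi> (Suc i) \<omega> / \<bar>\<xi> 0 \<omega>\<bar>)"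
proof (intro weighted_exchangeable.intro weighted_exchangeable_axioms.intro)
  have int [simp]: "integrable M (\<xi> i)" for i
    using swap by (simp add: swap_invariant_def)
  note [measurable] = borel_measurable_integrable[OF int]
  show "prob_space M" "integrable M (\<lambda>\<omega>. \<bar>\<xi> 0 \<omega>\<bar>)" "AE \<omega> in M. 0 < \<bar>\<xi> 0 \<omega>\<bar>" "0 \<le> \<bar>\<xi> 0 \<omega>\<bar>" for \<omega>
    using assms by auto
  show "(\<lambda>\<omega>. \<xi> (Suc i) \<omega> / \<bar>\<xi> 0 \<omega>\<bar>) \<in> borel_measurable M" for i by measurable
  fix p :: "nat \<Rightarrow> nat" assume "permutation p"
  then obtain S where "finite S" and S: "p permutes S"
    by (auto simp: permutation_permutes)
  then obtain N where N: "S \<subseteq> {..<N}"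
    using finite_nat_iff_bounded by blast
  define Q where "Q = density M (\<lambda>\<omega>. ennreal \<bar>\<xi> 0 \<omega>\<bar>)"
  define Z where "Z s \<omega> i = \<xi> (Suc (s i)) \<omega> / \<bar>\<xi> 0 \<omega>\<bar>" for s :: "nat \<Rightarrow> nat" and \<omega> i
  have Z [measurable]: "Z s \<in> measurable Q borel_seq" for s
    unfolding Q_def Z_def by (intro measurable_PiM_single') auto
  have "finite_measure Q"
    unfolding Q_def by (intro finite_measureI) (simp add: emeasure_density nn_integral_eq_integral)
  have cos_Z: "(\<integral>x. cos ((\<Sum>j<n. v j * x j) + a) \<partial>distr Q borel_seq (Z s))
      = cos a * (\<integral>\<omega>. \<bar>\<xi> 0 \<omega>\<bar> * cos (\<Sum>j<n. v j * (\<xi> (Suc (s j)) \<omega> / \<xi> 0 \<omega>)) \<partial>M)" for n v a s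
  proof -
    have "(\<integral>x. cos ((\<Sum>j<n. v j * x j) + a) \<partial>distr Q borel_seq (Z s)) = (\<integral>\<omega>. cos ((\<Sum>j<n. v j * Z s \<omega> j) + a) \<partial>Q)"
      by (rule integral_distr[OF Z]) measurable
    also have "\<dots> = (\<integral>\<omega>. \<bar>\<xi> 0 \<omega>\<bar> * cos ((\<Sum>j<n. v j * Z s \<omega> j) + a) \<partial>M)"
      unfolding Q_def Z_def by (simp add: integral_density)
    finally show ?thesis
      unfolding Z_def symmetric_cos_integral[OF int sym] .
  qed
  have "distr Q borel_seq (Z p) = distr Q borel_seq (Z (\<lambda>i. i))"
  proof (rule measure_eq_of_cos)
    show "finite_measure (distr Q borel_seq (Z p))" "finite_measure (distr Q borel_seq (Z (\<lambda>i. i)))"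
      using Z by (auto intro: finite_measure.finite_measure_distr[OF \<open>finite_measure Q\<close>])
    fix n :: nat and v :: "nat \<Rightarrow> real" and a :: real
    \<comment> \<open>\<open>p\<close> need not map the first \<open>n\<close> indices to
      themselves. The linear form is padded with zero coefficients up to a length that contains the
      support of \<open>p\<close>.\<close>
    define m where "m = max n N"
    define u where "u j = (if j < n then v j else 0)" for j :: nat
    have ext: "(\<Sum>j<n. v j * x j) = (\<Sum>j<m. u j * x j)" for x :: "nat \<Rightarrow> real"
      unfolding u_def m_def by (intro sum.mono_neutral_cong_left) auto
    have "p permutes {..<m}"
      using N by (intro permutes_subset[OF S]) (auto simp: m_def)
    then show "(\<integral>x. cos ((\<Sum>j<n. v j * x j) + a) \<partial>distr Q borel_seq (Z p))
        = (\<integral>x. cos ((\<Sum>j<n. v j * x j) + a) \<partial>distr Q borel_seq (Z (\<lambda>i. i)))"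
      unfolding ext cos_Z by (simp only: swap_invariant_cos_integral[OF swap nz])
  qed simp_all
  then show "distr (density M (\<lambda>\<omega>. ennreal \<bar>\<xi> 0 \<omega>\<bar>)) borel_seq (\<lambda>\<omega> i. \<xi> (Suc (p i)) \<omega> / \<bar>\<xi> 0 \<omega>\<bar>) =
      distr (density M (\<lambda>\<omega>. ennreal \<bar>\<xi> 0 \<omega>\<bar>)) borel_seq (\<lambda>\<omega> i. \<xi> (Suc i) \<omega> / \<bar>\<xi> 0 \<omega>\<bar>)"
    by (simp add: Q_def Z_def[abs_def])
qed

section \<open>Restoring the first term of the averages\<close>

lemma average_Suc_shift:
  fixes x :: "nat \<Rightarrow> real"
  shows "(\<Sum>i<Suc n. x i) / Suc n = x 0 * inverse (real (Suc n)) + n / Suc n * ((\<Sum>i<n. x (Suc i)) / n)"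
proof (cases "n = 0")
  case False
  then have "n / Suc n * ((\<Sum>i<n. x (Suc i)) / n) = (\<Sum>i<n. x (Suc i)) / Suc n"
    by (simp del: of_nat_Suc)
  then show ?thesis
    by (simp only: sum.lessThan_Suc_shift add_divide_distrib distrib_right divide_inverse)
qed simp

text \<open>The first term receives weight 1/(n+1), which vanishes, and the average of the others
  weight n/(n+1), which tends to 1.\<close>

lemma tendsto_averages_shift:
  fixes x :: "nat \<Rightarrow> real"
  assumes "(\<lambda>n. (\<Sum>i<n. x (Suc i)) / n) \<longlonglongrightarrow> l"
  shows "(\<lambda>n. (\<Sum>i<n. x i) / n) \<longlonglongrightarrow> l"
proof -
  have "(\<lambda>n. x 0 * inverse (real (Suc n)) + real n / real (Suc n) * ((\<Sum>i<n. x (Suc i)) / n)) \<longlonglongrightarrow> x 0 * 0 + 1 * l"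
    by (intro tendsto_intros assms LIMSEQ_inverse_real_of_nat LIMSEQ_n_over_Suc_n)
  then have "(\<lambda>n. (\<Sum>i<Suc n. x i) / Suc n) \<longlonglongrightarrow> l"
    unfolding average_Suc_shift by simp
  then show ?thesis by (rule LIMSEQ_imp_Suc)
qed

lemma tendsto_L1_averages_shift:
  fixes X :: "nat \<Rightarrow> 'a \<Rightarrow> real"
  assumes int: "\<And>i. integrable M (X i)" "integrable M g"
    and lim: "(\<lambda>n. \<integral>\<omega>. \<bar>(\<Sum>i<n. X (Suc i) \<omega>) / n - g \<omega>\<bar> \<partial>M) \<longlonglongrightarrow> 0"
  shows "(\<lambda>n. \<integral>\<omega>. \<bar>(\<Sum>i<n. X i \<omega>) / n - g \<omega>\<bar> \<partial>M) \<longlonglongrightarrow> 0"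
proof (rule LIMSEQ_imp_Suc, rule tendsto_sandwich[OF _ _ tendsto_const])
  define A where "A n \<omega> = (\<Sum>i<n. X (Suc i) \<omega>) / n" for n \<omega>
  have A: "integrable M (A n)" for n
    unfolding A_def using int by simp
  show "\<forall>\<^sub>F n in sequentially. 0 \<le> (\<integral>\<omega>. \<bar>(\<Sum>i<Suc n. X i \<omega>) / Suc n - g \<omega>\<bar> \<partial>M)"
    by (simp add: Bochner_Integration.integral_nonneg del: sum.lessThan_Suc)
  have "(\<integral>\<omega>. \<bar>(\<Sum>i<Suc n. X i \<omega>) / Suc n - g \<omega>\<bar> \<partial>M)
      \<le> (\<integral>\<omega>. \<bar>X 0 \<omega> - g \<omega>\<bar> * inverse (real (Suc n)) + \<bar>A n \<omega> - g \<omega>\<bar> \<partial>M)" for n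
  proof (rule integral_mono)
    fix \<omega>
    \<comment> \<open>The weights 1/(n+1) and n/(n+1) add up to 1, so \<open>g\<close> can be split
      with the same weights as the average.\<close>
    have split: "(\<Sum>i<Suc n. X i \<omega>) / Suc n - g \<omega>
        = (X 0 \<omega> - g \<omega>) * inverse (real (Suc n)) + n / Suc n * (A n \<omega> - g \<omega>)"
    proof -
      have "inverse (real (Suc n)) + n / Suc n = 1"
        by (simp add: field_simps)
      then have "g \<omega> = g \<omega> * inverse (real (Suc n)) + n / Suc n * g \<omega>"
        by (metis distrib_left mult.commute mult.right_neutral)
      then show ?thesis
        unfolding average_Suc_shift[of "\<lambda>i. X i \<omega>"] by (simp add: A_def algebra_simps del: of_nat_Suc)
    qed
    have first: "\<bar>(X 0 \<omega> - g \<omega>) * inverse (real (Suc n))\<bar> = \<bar>X 0 \<omega> - g \<omega>\<bar> * inverse (real (Suc n))"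
      by (simp add: abs_mult del: of_nat_Suc)
    have rest: "\<bar>n / Suc n * (A n \<omega> - g \<omega>)\<bar> \<le> \<bar>A n \<omega> - g \<omega>\<bar>"
      unfolding abs_mult by (rule mult_left_le_one_le) simp_all
    show "\<bar>(\<Sum>i<Suc n. X i \<omega>) / Suc n - g \<omega>\<bar>
        \<le> \<bar>X 0 \<omega> - g \<omega>\<bar> * inverse (real (Suc n)) + \<bar>A n \<omega> - g \<omega>\<bar>"
      unfolding split first[symmetric] by (rule order_trans[OF abs_triangle_ineq add_left_mono[OF rest]])
  qed (use int A in \<open>auto simp del: of_nat_Suc\<close>)
  then show "\<forall>\<^sub>F n in sequentially. (\<integral>\<omega>. \<bar>(\<Sum>i<Suc n. X i \<omega>) / Suc n - g \<omega>\<bar> \<partial>M)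
      \<le> (\<integral>\<omega>. \<bar>X 0 \<omega> - g \<omega>\<bar> \<partial>M) * inverse (real (Suc n)) + (\<integral>\<omega>. \<bar>A n \<omega> - g \<omega>\<bar> \<partial>M)"
    using int A by (simp del: of_nat_Suc sum.lessThan_Suc)
  show "(\<lambda>n. (\<integral>\<omega>. \<bar>X 0 \<omega> - g \<omega>\<bar> \<partial>M) * inverse (real (Suc n)) + (\<integral>\<omega>. \<bar>A n \<omega> - g \<omega>\<bar> \<partial>M)) \<longlonglongrightarrow> 0"
    using tendsto_add[OF tendsto_mult_left[OF LIMSEQ_inverse_real_of_nat] lim, of "\<integral>\<omega>. \<bar>X 0 \<omega> - g \<omega>\<bar> \<partial>M"]
    by (simp add: A_def del: of_nat_Suc)
qed

text \<open>This is the weighted law of large numbers for the identity function with weight |\<xi>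
  0|. Multiplying by the weight turns the ratios back into the terms from the second on, and the
  missing first term is negligible in the averages.\<close>

theorem theorem21:
  fixes M :: "'a measure" and \<xi> \<xi>' :: "nat \<Rightarrow> 'a \<Rightarrow> real"
    and F :: "'a measure" and L :: "'a \<Rightarrow> real"
  assumes "prob_space M"
    and "swap_invariant M \<xi>"
    and "symmetric_seq M \<xi>"
    and "AE \<omega> in M. \<xi> 0 \<omega> \<noteq> 0"
  defines "\<xi>' \<equiv> \<lambda>i \<omega>. \<xi> (Suc i) \<omega> / \<bar>\<xi> 0 \<omega>\<bar>"
  defines "F \<equiv> perm_invariant_field M \<xi>'"
  defines "L \<equiv> \<lambda>\<omega>. \<bar>\<xi> 0 \<omega>\<bar> / real_cond_exp M F (\<lambda>\<omega>. \<bar>\<xi> 0 \<omega>\<bar>) \<omega> * real_cond_exp M F (\<xi> 1) \<omega>"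
  shows "(AE \<omega> in M. (\<lambda>n. (\<Sum>i<n. \<xi> i \<omega>) / real n) \<longlonglongrightarrow> L \<omega>)
       \<and> converges_L1 M (\<lambda>n \<omega>. (\<Sum>i<n. \<xi> i \<omega>) / real n) L"
proof -
  interpret W: weighted_exchangeable M "\<lambda>\<omega>. \<bar>\<xi> 0 \<omega>\<bar>" \<xi>'
    unfolding \<xi>'_def by (rule swap_invariant_imp_weighted_exchangeable[OF assms(1-4)])
  have F: "W.F = F" by (simp add: W.F_def F_def)
  have int: "integrable M (\<xi> i)" for i
    using assms(2) by (simp add: swap_invariant_def)
  note [measurable] = borel_measurable_integrable[OF int]
  \<comment> \<open>Only almost everywhere: where \<xi> 0 vanishes, division by zero makes the left
    side 0.\<close>
  have unscale: "AE \<omega> in M. \<forall>i. \<bar>\<xi> 0 \<omega>\<bar> * \<xi>' i \<omega> = \<xi> (Suc i) \<omega>"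
    using assms(4) by eventually_elim (simp add: \<xi>'_def)
  have sum_unscale: "AE \<omega> in M. \<forall>n. \<bar>\<xi> 0 \<omega>\<bar> * (\<Sum>i<n. \<xi>' i \<omega>) = (\<Sum>i<n. \<xi> (Suc i) \<omega>)"
    using unscale by eventually_elim (simp add: sum_distrib_left)
  have unscale0: "AE \<omega> in M. \<bar>\<xi> 0 \<omega>\<bar> * \<xi>' 0 \<omega> = \<xi> 1 \<omega>"
    using unscale by eventually_elim simp
  have int': "integrable M (\<lambda>\<omega>. \<bar>\<xi> 0 \<omega>\<bar> * \<xi>' 0 \<omega>)"
    using int[of 1] by (subst integrable_cong_AE[OF _ _ unscale0]) auto
  have id_meas: "(\<lambda>x :: real. x) \<in> borel_measurable borel" by simp
  \<comment> \<open>The weighted first ratio agrees almost surely with \<xi> 1, so the abstract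
    numerator is the conditional expectation in the claim.\<close>
  have "AE \<omega> in M. W.G (\<lambda>x. x) \<omega> = real_cond_exp M F (\<xi> 1) \<omega>"
    unfolding F by (rule W.real_cond_exp_cong[unfolded F, OF unscale0]) measurable
  then have L: "AE \<omega> in M. \<bar>\<xi> 0 \<omega>\<bar> * (W.G (\<lambda>x. x) \<omega> / W.D \<omega>) = L \<omega>"
    by eventually_elim (simp add: L_def F)
  have [measurable]: "L \<in> borel_measurable M"
    unfolding L_def by measurable
  have "AE \<omega> in M. (\<lambda>n. (\<Sum>i<n. \<xi> i \<omega>) / real n) \<longlonglongrightarrow> L \<omega>"
    using W.AE_averages[OF id_meas int'] L sum_unscale
  proof eventually_elim
    case (elim \<omega>)
    have eq: "\<bar>\<xi> 0 \<omega>\<bar> * ((\<Sum>i<n. \<xi>' i \<omega>) / n) = (\<Sum>i<n. \<xi> (Suc i) \<omega>) / n" for n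
      unfolding times_divide_eq_right elim(3)[rule_format] ..
    show ?case
      using tendsto_mult_left[OF elim(1), of "\<bar>\<xi> 0 \<omega>\<bar>"] unfolding eq elim(2)
      by (rule tendsto_averages_shift)
  qed
  moreover have "converges_L1 M (\<lambda>n \<omega>. (\<Sum>i<n. \<xi> i \<omega>) / real n) L"
    unfolding converges_L1_def
  proof (intro conjI allI)
    show intL: "integrable M L"
      by (rule iffD1[OF integrable_cong_AE[OF _ _ L] W.averages_L1(1)[OF id_meas int']]) measurable
    show "integrable M (\<lambda>\<omega>. (\<Sum>i<n. \<xi> i \<omega>) / real n)" for n
      using int by simp
    have averages_eq: "(\<integral>\<omega>. \<bar>\<bar>\<xi> 0 \<omega>\<bar> * (\<Sum>i<n. \<xi>' i \<omega>) / n - \<bar>\<xi> 0 \<omega>\<bar> * (W.G (\<lambda>x. x) \<omega> / W.D \<omega>)\<bar> \<partial>M)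
        = (\<integral>\<omega>. \<bar>(\<Sum>i<n. \<xi> (Suc i) \<omega>) / n - L \<omega>\<bar> \<partial>M)" for n
    proof (rule integral_cong_AE)
      show "AE \<omega> in M. \<bar>\<bar>\<xi> 0 \<omega>\<bar> * (\<Sum>i<n. \<xi>' i \<omega>) / n - \<bar>\<xi> 0 \<omega>\<bar> * (W.G (\<lambda>x. x) \<omega> / W.D \<omega>)\<bar>
          = \<bar>(\<Sum>i<n. \<xi> (Suc i) \<omega>) / n - L \<omega>\<bar>"
        using L sum_unscale by eventually_elim (simp only:)
    qed measurable
    show "(\<lambda>n. \<integral>\<omega>. \<bar>(\<Sum>i<n. \<xi> i \<omega>) / real n - L \<omega>\<bar> \<partial>M) \<longlonglongrightarrow> 0"
      by (rule tendsto_L1_averages_shift[OF int intL W.averages_L1(2)[OF id_meas int', unfolded averages_eq]])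
  qed
  ultimately show ?thesis ..
qed

end
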